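(* Fix an integer $p\ge 1$ and, for $n\ge p$, let $X_{n,p}$ be the number of passes in the Multiple Quickselect algorithm that are required to find a random order statistic of $p$ elements in a data file of size $n$. Then $X_{n,p}$ is asymptotically Gaussian as $n\to\infty$, with convergence rate of order $\mathcal{O}(1/\sqrt{\log n})$: $$\mathbb{P}\left\{\frac{X_{n,p}-2p\log n}{\sqrt{2p\log n}}<x\right\}=\Phi(x)+\mathcal{O}\left(\frac{1}{\sqrt{\log n}}\right),$$ uniformly with respect to $x\in\mathbb{R}$. Moreover, for every $\varepsilon>0$, the expectation $E_{n,p}=\mathbb{E}(X_{n,p})$ and the variance $V_{n,p}=\mathbb{V}(X_{n,p})$ satisfy, as $n\to\infty$, $$E_{n,p}=2p\log n+1-2p-2pH_p+2p\gamma+\mathcal{O}\left(\frac{1}{n^{1-\varepsilon}}\right),$$ $$V_{n,p}=2p\log n+4p-2-2pH_p+2p\gamma+4p^2H_p^{(2)}-\frac{2}{3}\pi^2p^2+\mathcal{O}\left(\frac{1}{n^{1-\varepsilon}}\right).$$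
   Context: Multiple Quickselect is the following divide-and-conquer algorithm for finding the elements of prescribed ranks $1\le i_1<\dots<i_p\le n$ in a data file of $n$ distinct elements. If the set of sought ranks is empty, nothing is done (no pass). Otherwise one pass is performed: a pivot element (say the first element of the file) is chosen, and the file is partitioned into the subfile of elements smaller than the pivot and the subfile of elements larger than the pivot; if the pivot has rank $k$, then the algorithm is applied recursively to the left subfile with the sought ranks that are $<k$ and to the right subfile with the sought ranks that are $>k$ (shifted by $k$), where a subfile containing no sought rank is not processed further. The number of passes is the total number of partitioning steps performed. Probability model: the ranks of the data form a uniformly random permutation of $\{1,\dots,n\}$ (and subfiles are again random permutations, the two being independent given the rank of the pivot), and, independently, the set $\{i_1<\dots<i_p\}$ of sought ranks is uniformly distributed over all $\binom{n}{p}$ subsets of $\{1,\dots,n\}$ of size $p$. $X_{n,p}$ is the resulting random number of passes. Equivalently, $X_{n,p}$ is the number of ascendants (each node counting as an ascendant of itself) of $p$ uniformly randomly chosen distinct nodes in a random binary search tree of size $n$ (built by inserting a uniformly random permutation of $\{1,\dots,n\}$ into an initially empty tree), i.e. the number of nodes of the smallest subtree containing the root and the $p$ chosen nodes. Notation: $H_m=\sum_{k=1}^m\frac1k$, $H_m^{(2)}=\sum_{k=1}^m\frac1{k^2}$, $\gamma$ is the Euler–Mascheroni constant, $\log$ is the natural logarithm, and $\Phi(x)$ is the distribution function of the standard normal distribution $\mathcal{N}(0,1)$. The constants implied by the $\mathcal{O}$-terms may depend on $p$ (and on $\varepsilon$ where it occurs). *)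

theory Defs
  imports "HOL-Probability.Probability" "HOL-Combinatorics.Multiset_Permutations"
begin

text \<open>
  Ranks are counted from 1, and \<^term>\<open>xs\<close> is meant to have distinct elements. If \<^term>\<open>I\<close> is a
  set of ranks between 1 and the length of \<^term>\<open>xs\<close>, this is preserved by the recursion, so the
  first equation is only reached with \<^term>\<open>I = {}\<close>.
\<close>

function mqs_passes :: "'a::linorder list \<Rightarrow> nat set \<Rightarrow> nat" where
  "mqs_passes [] I = 0"
| "mqs_passes (x # xs) I =
     (if I = {} then 0
      else (let ls = filter (\<lambda>y. y < x) xs;
                rs = filter (\<lambda>y. y > x) xs;
                k = length ls + 1
            in 1 + mqs_passes ls {i \<in> I. i < k}
                 + mqs_passes rs ((\<lambda>i. i - k) ` {i \<in> I. i > k})))"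
  by pat_completeness auto
termination
  by (relation "Wellfounded.measure (\<lambda>(xs, I). length xs)") (auto simp: less_Suc_eq_le)

text \<open>Only meaningful for \<^term>\<open>p \<le> n\<close>: otherwise the set of \<^term>\<open>p\<close>-subsets is empty.\<close>

definition mqs_input :: "nat \<Rightarrow> nat \<Rightarrow> (nat list \<times> nat set) pmf" where
  "mqs_input n p =
     pair_pmf (pmf_of_set (permutations_of_set {1..n}))
              (pmf_of_set {I. I \<subseteq> {1..n} \<and> card I = p})"

definition X_mqs :: "nat list \<times> nat set \<Rightarrow> real" where
  "X_mqs = (\<lambda>(xs, I). real (mqs_passes xs I))"

definition E_mqs :: "nat \<Rightarrow> nat \<Rightarrow> real" where
  "E_mqs n p = measure_pmf.expectation (mqs_input n p) X_mqs"

definition V_mqs :: "nat \<Rightarrow> nat \<Rightarrow> real" where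
  "V_mqs n p = measure_pmf.variance (mqs_input n p) X_mqs"

definition harm2 :: "nat \<Rightarrow> real" where
  "harm2 m = (\<Sum>k=1..m. 1 / (real k)\<^sup>2)"

end

theory Submission
  imports Defs "HOL-Complex_Analysis.Complex_Analysis" "HOL-Real_Asymp.Real_Asymp"
begin

text \<open>
  Put \<open>w = 2 v - 1\<close> and let \<open>F\<^sub>p(n)\<close> be the sum, over all \<open>p\<close>-subsets of the ranks, of the mean of
  \<open>v\<close> to the number of passes, so that \<open>F\<^sub>p(n)\<close> divided by \<open>n choose p\<close> is the probability generating
  function of \<open>X\<^sub>n\<^sub>,\<^sub>p\<close>. Conditioning on the pivot turns the series \<open>F\<^sub>p(z) = \<Sum> F\<^sub>p(n) z^n\<close> into a solution of
  \<open>F\<^sub>p' = 2 v F\<^sub>p / (1 - z) + v R\<^sub>p\<close>, where \<open>R\<^sub>p\<close> is a sum of products of the series with smaller index.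
  By induction on \<open>p\<close>, \<open>F\<^sub>p\<close> is \<open>(v/w)^(2p-1) (1 - z)^(-1-pw)\<close> up to terms that are smaller by almost a
  full factor \<open>1 - z\<close>, uniformly for complex \<open>v\<close> near 1 (\<open>passes_gf_asymptotics_upto\<close>). The induction
  is carried out on coefficients: the coefficients of \<open>(1 - z)^(-a)\<close> with real \<open>a\<close> are the majorants,
  and since they convolve exactly, convolution sums are bounded without any loss.

  After division by \<open>n choose p\<close> the main term becomes
  \<open>(v/w)^(2p-1) \<Prod>\<^sub>k (1 + 2p/(p+k) (v - 1))\<close>, apart from a factor \<open>1 + O(n^(\<epsilon>-1))\<close>, which is
  read off from the same estimate at \<open>v = 1\<close>, where the generating function is 1.
  The product is the generating function of a sum of independent Bernoulli variables with total mean
  \<open>2 p log n + O(1)\<close> (if the finitely many factors with \<open>k < p\<close> are ignored), which is where the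
  normal law comes from.

  Mean and variance (\<open>moment_asymptotics\<close>) come from the derivatives at \<open>v = 1\<close>. The remainder is
  holomorphic in \<open>v\<close>, so Cauchy's inequality bounds its derivatives as well, and the derivatives of the
  product are harmonic sums.

  For the normal approximation, \<open>v = exp (i \<theta>)\<close> with \<open>\<theta>\<close> in a fixed small interval makes the main term
  \<open>exp (2 p log n (v - 1) + O(\<theta>))\<close>, whence the characteristic function of the centred variable differs
  from the Gaussian one by \<open>O(\<theta> / (1 + \<theta>\<^sup>2 log n))\<close> plus a negligible amount (\<open>passes_pgf_iexp\<close>). Only
  small \<open>\<theta>\<close> are under control; Esseen's smoothing inequality (\<open>Esseen_smoothing_unit\<close>) is tailored to
  this situation and yields the rate.
\<close>

section \<open>Coefficients of powers of \<open>1/(1 - z)\<close>\<close>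

text \<open>
  The coefficient of \<open>z^n\<close> in \<open>(1 - z)^(-a)\<close>; for real \<open>a > 0\<close> its order of growth is \<open>n^(a-1)\<close>.
\<close>

definition binc :: "'a::field_char_0 \<Rightarrow> nat \<Rightarrow> 'a" where
  "binc a n = pochhammer a n / fact n"

lemma binc_0 [simp]: "binc a 0 = 1" by (simp add: binc_def)

lemma binc_1 [simp]: "binc 1 n = 1"
  by (simp add: binc_def pochhammer_fact [symmetric])

text \<open>
  The product rule \<open>(1 - z)^(-a) (1 - z)^(-b) = (1 - z)^(-a-b)\<close>, an instance of Chu-Vandermonde.
\<close>

lemma binc_convolution: "(\<Sum>k\<le>n. binc a k * binc b (n - k)) = binc (a + b) n"
proof -
  have "binc (a + b) n = (\<Sum>k\<le>n. of_nat (n choose k) * pochhammer a k * pochhammer b (n - k)) / fact n"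
    by (simp add: binc_def pochhammer_binomial_sum)
  also have "\<dots> = (\<Sum>k\<le>n. binc a k * binc b (n - k))"
    by (auto simp: sum_divide_distrib binc_def binomial_fact divide_simps intro!: sum.cong)
  finally show ?thesis ..
qed

lemma binc_sum: "(\<Sum>k\<le>n. binc a k) = binc (a + 1) n"
  using binc_convolution[of a 1 n] by simp

text \<open>
  This is the derivative of \<open>(1 - z)^(-a)\<close>, read on coefficients.
\<close>

lemma binc_deriv: "of_nat (Suc n) * binc a (Suc n) = a * binc (a + 1) n"
  by (simp add: binc_def pochhammer_rec divide_simps del: of_nat_Suc)

lemma binc_nonneg: "a \<ge> 0 \<Longrightarrow> binc (a::real) n \<ge> 0"
  by (simp add: binc_def pochhammer_nonneg pochhammer_of_nat pochhammer_prod prod_nonneg)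

text \<open>
  Triangle inequality in every factor of the rising factorial. The majorant depends on a bound for
  \<open>a\<close> only, which gives uniformity in a complex parameter at no cost.
\<close>

lemma norm_binc_le:
  fixes a :: complex
  assumes "norm a \<le> b" shows "norm (binc a n) \<le> binc b n"
proof -
  have "b \<ge> 0" using assms norm_ge_zero order_trans by blast
  have "norm (\<Prod>i<n. a + of_nat i) \<le> (\<Prod>i<n. b + real i)"
    unfolding prod_norm[symmetric]
  proof (rule prod_mono, safe)
    fix i show "norm (a + of_nat i) \<le> b + real i"
      using assms norm_triangle_ineq[of a "of_nat i"] by simp
  qed auto
  thus ?thesis
    by (simp add: binc_def pochhammer_prod norm_divide atLeast0LessThan divide_right_mono)
qed

lemma binc_mono: "0 \<le> a \<Longrightarrow> a \<le> b \<Longrightarrow> binc (a::real) n \<le> binc b n"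
  unfolding binc_def pochhammer_prod
  by (intro divide_right_mono prod_mono) auto

lemma binc_ge_1: "1 \<le> a \<Longrightarrow> 1 \<le> binc (a::real) n"
  using binc_mono[of 1 a n] by simp

section \<open>The pivot recurrence\<close>

lemma mqs_passes_empty [simp]: "mqs_passes xs {} = 0"
  by (cases xs) auto

text \<open>
  The algorithm does nothing but compare elements.
\<close>

lemma mqs_passes_map:
  assumes "strict_mono_on (set xs) g"
  shows   "mqs_passes (map g xs) I = mqs_passes xs I"
  using assms
proof (induction xs I rule: mqs_passes.induct)
  case (2 x xs I)
  have less_iff: "g y < g z \<longleftrightarrow> y < z" if "y \<in> set (x # xs)" "z \<in> set (x # xs)" for y z
    using strict_mono_on_less[OF "2.prems"] that by blast
  have l: "filter (\<lambda>y. y < g x) (map g xs) = map g (filter (\<lambda>y. y < x) xs)"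
    and r: "filter (\<lambda>y. g x < y) (map g xs) = map g (filter (\<lambda>y. x < y) xs)"
    by (auto simp: filter_map o_def less_iff intro!: arg_cong[where f = "map g"] filter_cong)
  have sub: "strict_mono_on (set (filter P xs)) g" for P
    using "2.prems" by (auto simp: strict_mono_on_def)
  show ?case
  proof (cases "I = {}")
    case False
    thus ?thesis
      unfolding list.map mqs_passes.simps l r
      using "2.IH"(1)[OF False refl refl refl sub] "2.IH"(2)[OF False refl refl refl sub]
      by (simp add: Let_def)
  qed simp
qed auto

lemma expectation_pair_pmf_mult:
  fixes f :: "'a \<Rightarrow> complex" and g :: "'b \<Rightarrow> complex"
  assumes "finite (set_pmf P)" "finite (set_pmf Q)"
  shows "measure_pmf.expectation (pair_pmf P Q) (\<lambda>(x, y). f x * g y) =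
         measure_pmf.expectation P f * measure_pmf.expectation Q g"
proof -
  have "measure_pmf.expectation (pair_pmf P Q) (\<lambda>(x, y). f x * g y) =
        (\<Sum>(x,y)\<in>set_pmf P \<times> set_pmf Q. (pmf P x *\<^sub>R f x) * (pmf Q y *\<^sub>R g y))"
    using assms by (subst integral_measure_pmf[of "set_pmf P \<times> set_pmf Q"])
      (auto simp: pmf_pair scaleR_conv_of_real mult_ac intro!: sum.cong)
  also have "\<dots> = (\<Sum>x\<in>set_pmf P. pmf P x *\<^sub>R f x) * (\<Sum>y\<in>set_pmf Q. pmf Q y *\<^sub>R g y)"
    by (simp add: sum_product sum.cartesian_product)
  also have "\<dots> = measure_pmf.expectation P f * measure_pmf.expectation Q g"
    using assms by (simp add: integral_measure_pmf[of "set_pmf P"] integral_measure_pmf[of "set_pmf Q"])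
  finally show ?thesis .
qed

definition rank_pgf :: "nat \<Rightarrow> nat set \<Rightarrow> complex \<Rightarrow> complex" where
  "rank_pgf n I v =
     measure_pmf.expectation (pmf_of_set (permutations_of_set {1..n})) (\<lambda>xs. v ^ mqs_passes xs I)"

lemma rank_pgf_empty [simp]: "rank_pgf n {} v = 1"
  by (simp add: rank_pgf_def)

text \<open>
  Needed for the right subfile, whose elements are \<open>{k+1..n}\<close> instead of \<open>{1..n-k}\<close>.
\<close>

lemma rank_pgf_relabel:
  fixes A :: "nat set"
  assumes "strict_mono_on {1..n} g" "A = g ` {1..n}"
  shows "measure_pmf.expectation (pmf_of_set (permutations_of_set A)) (\<lambda>xs. v ^ mqs_passes xs I) =
         rank_pgf n I v"
proof -
  have inj: "inj_on g {1..n}"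
    using assms(1) by (rule strict_mono_on_imp_inj_on)
  have inj': "inj_on (map g) (permutations_of_set {1..n})"
    by (rule inj_on_mapI, rule inj_on_subset[OF inj]) (auto simp: permutations_of_set_def)
  have "pmf_of_set (permutations_of_set A) =
        map_pmf (map g) (pmf_of_set (permutations_of_set {1..n}))"
    unfolding assms(2) permutations_of_set_image_inj[OF inj]
    by (rule map_pmf_of_set_inj [symmetric]) (use inj' in auto)
  hence "measure_pmf.expectation (pmf_of_set (permutations_of_set A)) (\<lambda>xs. v ^ mqs_passes xs I) =
        measure_pmf.expectation (pmf_of_set (permutations_of_set {1..n})) (\<lambda>xs. v ^ mqs_passes (map g xs) I)"
    by simp
  also have "\<dots> = rank_pgf n I v"
    unfolding rank_pgf_def
    by (intro integral_cong_AE)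
       (auto simp: AE_measure_pmf_iff intro!: arg_cong[where f = "\<lambda>k. v ^ k"] mqs_passes_map
              dest!: permutations_of_setD(1) simp: assms(1)[simplified])
  finally show ?thesis .
qed

text \<open>
  Partitioning a random permutation at the pivot produces two independent random permutations, so
  the mean of the power of \<open>v\<close> factorises.
\<close>

lemma rank_pgf_pivot:
  assumes k: "k \<in> {1..n}" and I: "I \<noteq> {}"
  shows "measure_pmf.expectation (pmf_of_set (permutations_of_set ({1..n} - {k})))
           (\<lambda>xs. v ^ mqs_passes (k # xs) I) =
         v * (rank_pgf (k - 1) {i\<in>I. i < k} v * rank_pgf (n - k) ((\<lambda>i. i - k) ` {i\<in>I. k < i}) v)"
proof -
  define A where "A = {1..n} - {k}"
  define f where "f = (\<lambda>ls :: nat list. v ^ mqs_passes ls {i\<in>I. i < k})"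
  define g where "g = (\<lambda>rs :: nat list. v ^ mqs_passes rs ((\<lambda>i. i - k) ` {i\<in>I. k < i}))"
  have [simp]: "finite A" by (simp add: A_def)
  have passes: "v ^ mqs_passes (k # xs) I = v * (case partition (\<lambda>y. y < k) xs of (ls, rs) \<Rightarrow> f ls * g rs)"
    if "xs \<in> permutations_of_set A" for xs
  proof -
    have xs: "set xs = A" "distinct xs"
      using that by (auto simp: permutations_of_set_def)
    have "length (filter (\<lambda>y. y < k) xs) = card {y\<in>A. y < k}"
      using distinct_card[of "filter (\<lambda>y. y < k) xs"] xs by simp
    also have "{y\<in>A. y < k} = {1..<k}" using k by (auto simp: A_def)
    finally have len: "length (filter (\<lambda>y. y < k) xs) + 1 = k" using k by simp
    have "filter (\<lambda>y. k < y) xs = filter (\<lambda>y. \<not>y < k) xs"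
    proof (rule filter_cong[OF refl])
      fix y assume "y \<in> set xs"
      hence "y \<noteq> k" using xs(1) by (simp add: A_def)
      thus "(k < y) = (\<not>y < k)" by auto
    qed
    thus ?thesis
      using I len by (simp add: Let_def f_def g_def power_add o_def)
  qed
  have low: "measure_pmf.expectation (pmf_of_set (permutations_of_set {x\<in>A. x < k})) f =
             rank_pgf (k - 1) {i\<in>I. i < k} v"
    unfolding f_def
    by (rule rank_pgf_relabel[where g = id]) (use k in \<open>auto simp: A_def strict_mono_on_def\<close>)
  have high_set: "{x\<in>A. \<not>x < k} = (\<lambda>i. i + k) ` {1..n - k}"
  proof (intro equalityI subsetI)
    fix x assume "x \<in> {x\<in>A. \<not>x < k}"
    hence "x = (x - k) + k" "x - k \<in> {1..n-k}" by (auto simp: A_def)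
    thus "x \<in> (\<lambda>i. i + k) ` {1..n - k}" by blast
  qed (use k in \<open>auto simp: A_def\<close>)
  have high: "measure_pmf.expectation (pmf_of_set (permutations_of_set {x\<in>A. \<not>x < k})) g =
             rank_pgf (n - k) ((\<lambda>i. i - k) ` {i\<in>I. k < i}) v"
    unfolding g_def by (rule rank_pgf_relabel[OF _ high_set]) (simp add: strict_mono_on_def)
  have "measure_pmf.expectation (pmf_of_set (permutations_of_set A)) (\<lambda>xs. v ^ mqs_passes (k # xs) I) =
        measure_pmf.expectation (pmf_of_set (permutations_of_set A))
          (\<lambda>xs. v * (case partition (\<lambda>y. y < k) xs of (ls, rs) \<Rightarrow> f ls * g rs))"
    by (intro integral_cong_AE) (auto simp: AE_measure_pmf_iff passes simp del: partition_filter_conv mqs_passes.simps)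
  also have "\<dots> = v * measure_pmf.expectation (map_pmf (partition (\<lambda>y. y < k)) (pmf_of_set (permutations_of_set A)))
          (\<lambda>(ls, rs). f ls * g rs)"
    by (simp del: partition_filter_conv)
  also have "map_pmf (partition (\<lambda>y. y < k)) (pmf_of_set (permutations_of_set A)) =
             pair_pmf (pmf_of_set (permutations_of_set {x\<in>A. x < k}))
                      (pmf_of_set (permutations_of_set {x\<in>A. \<not>x < k}))"
    by (rule partition_random_permutations) auto
  also have "measure_pmf.expectation \<dots> (\<lambda>(ls, rs). f ls * g rs) =
      rank_pgf (k - 1) {i\<in>I. i < k} v * rank_pgf (n - k) ((\<lambda>i. i - k) ` {i\<in>I. k < i}) v"
    unfolding low [symmetric] high [symmetric] by (rule expectation_pair_pmf_mult) auto
  finally show ?thesis unfolding A_def .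
qed

lemma rank_pgf_rec:
  assumes "n \<ge> 1" "I \<noteq> {}"
  shows "of_nat n * rank_pgf n I v =
         v * (\<Sum>k=1..n. rank_pgf (k - 1) {i\<in>I. i < k} v *
                rank_pgf (n - k) ((\<lambda>i. i - k) ` {i\<in>I. k < i}) v)"
proof -
  have ne: "{1..n} \<noteq> {}" using assms by auto
  have "rank_pgf n I v = measure_pmf.expectation (pmf_of_set {1..n} \<bind>
          (\<lambda>k. map_pmf ((#) k) (pmf_of_set (permutations_of_set ({1..n} - {k})))))
          (\<lambda>xs. v ^ mqs_passes xs I)"
    unfolding rank_pgf_def random_permutation_of_set[OF finite_atLeastAtMost ne] map_pmf_def ..
  also have "\<dots> = (\<Sum>k=1..n. measure_pmf.expectation
      (pmf_of_set (permutations_of_set ({1..n} - {k}))) (\<lambda>xs. v ^ mqs_passes (k # xs) I)) / of_nat n"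
    using ne by (subst pmf_expectation_bind_pmf_of_set)
      (auto simp: scaleR_conv_of_real sum_divide_distrib field_simps simp del: mqs_passes.simps intro!: sum.cong)
  also have "\<dots> = (\<Sum>k=1..n. v * (rank_pgf (k - 1) {i\<in>I. i < k} v *
                rank_pgf (n - k) ((\<lambda>i. i - k) ` {i\<in>I. k < i}) v)) / of_nat n"
    using rank_pgf_pivot[OF _ assms(2)] by (intro arg_cong[where f = "\<lambda>x. x / of_nat n"] sum.cong refl)
  finally show ?thesis using assms by (simp add: sum_distrib_left [symmetric])
qed

text \<open>
  A set of ranks corresponds to its part below \<open>k\<close>, its part above \<open>k\<close>, and its intersection \<open>E\<close> with
  \<open>{k}\<close>. Keeping \<open>E\<close> as a parameter covers the pivot being sought and not being sought in one statement.
\<close>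

lemma sum_subsets_split:
  fixes g h :: "nat set \<Rightarrow> complex"
  assumes k: "k \<in> {1..n}" and E: "E \<subseteq> {k}"
  shows "(\<Sum>I | I \<subseteq> {1..n} \<and> I \<inter> {k} = E \<and> card (I - {k}) = r.
            g {i\<in>I. i < k} * h ((\<lambda>i. i - k) ` {i\<in>I. k < i})) =
         (\<Sum>q\<le>r. (\<Sum>J | J \<subseteq> {1..k-1} \<and> card J = q. g J) *
                  (\<Sum>J | J \<subseteq> {1..n-k} \<and> card J = r - q. h J))"
proof -
  let ?S = "\<lambda>n q. {J. J \<subseteq> {1..n::nat} \<and> card J = q}"
  have fin: "finite (?S n q)" for n q
    by (rule finite_subset[of _ "Pow {1..n}"]) auto
  have "(\<Sum>I | I \<subseteq> {1..n} \<and> I \<inter> {k} = E \<and> card (I - {k}) = r.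
            g {i\<in>I. i < k} * h ((\<lambda>i. i - k) ` {i\<in>I. k < i})) =
        (\<Sum>(q, J, J') \<in> (SIGMA q:{..r}. ?S (k-1) q \<times> ?S (n-k) (r-q)). g J * h J')"
  proof (rule sum.reindex_bij_witness[where
      j = "\<lambda>I. (card {i\<in>I. i < k}, {i\<in>I. i < k}, (\<lambda>i. i - k) ` {i\<in>I. k < i})" and
      i = "\<lambda>(q, J, J'). J \<union> E \<union> (\<lambda>i. i + k) ` J'"], goal_cases)
    case (1 I)
    have "(\<lambda>i. i + k) ` (\<lambda>i. i - k) ` {i\<in>I. k < i} = {i\<in>I. k < i}"
      unfolding image_image by (rule image_cong[of _ _ _ id, simplified]) auto
    thus ?case using 1 by auto
  next
    case (2 I)
    hence I: "I \<subseteq> {1..n}" "card (I - {k}) = r" by auto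
    have finI: "finite I" using finite_subset[OF I(1)] by simp
    have "card ((\<lambda>i. i - k) ` {i\<in>I. k < i}) = card {i\<in>I. k < i}"
      by (intro card_image inj_onI) auto
    moreover have "card {i\<in>I. i < k} + card {i\<in>I. k < i} = card (I - {k})"
      using finI by (subst card_Un_disjoint [symmetric]) (auto intro!: arg_cong[where f = card])
    moreover have "{i\<in>I. i < k} \<subseteq> {1..k-1}" "(\<lambda>i. i - k) ` {i\<in>I. k < i} \<subseteq> {1..n-k}"
      using I(1) by (auto dest!: subsetD[OF I(1)])
    ultimately show ?case using I(2) by auto
  next
    case (3 z)
    then obtain q J J' where z: "z = (q, J, J')" "q \<le> r" "J \<subseteq> {1..k-1}" "card J = q"
      "J' \<subseteq> {1..n-k}" "card J' = r - q" by auto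
    let ?I = "J \<union> E \<union> (\<lambda>i. i + k) ` J'"
    have E_k: "i = k" if "i \<in> E" for i using E that by auto
    have J_less: "1 \<le> i \<and> i < k \<and> i \<le> n" if "i \<in> J" for i using subsetD[OF z(3) that] k by auto
    have J'_pos: "1 \<le> i \<and> i + k \<le> n" if "i \<in> J'" for i using subsetD[OF z(5) that] k by auto
    have low: "{i\<in>?I. i < k} = J" by (auto dest: E_k J_less J'_pos)
    have high: "{i\<in>?I. k < i} = (\<lambda>i. i + k) ` J'" by (auto dest: E_k J_less J'_pos)
    show ?case using z low high by (simp add: image_image)
  next
    case (4 z)
    then obtain q J J' where z: "z = (q, J, J')" "q \<le> r" "J \<subseteq> {1..k-1}" "card J = q"
      "J' \<subseteq> {1..n-k}" "card J' = r - q" by auto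
    let ?I = "J \<union> E \<union> (\<lambda>i. i + k) ` J'"
    have E_k: "i = k" if "i \<in> E" for i using E that by auto
    have J_less: "1 \<le> i \<and> i < k \<and> i \<le> n" if "i \<in> J" for i using subsetD[OF z(3) that] k by auto
    have J'_pos: "1 \<le> i \<and> i + k \<le> n" if "i \<in> J'" for i using subsetD[OF z(5) that] k by auto
    have sub: "?I \<subseteq> {1..n}" using k by (auto dest!: E_k dest: J_less J'_pos)
    have "?I \<inter> {k} = E" using E by (auto dest: E_k J_less J'_pos)
    moreover have "?I - {k} = J \<union> (\<lambda>i. i + k) ` J'" by (auto dest: E_k J_less J'_pos)
    moreover have "card (J \<union> (\<lambda>i. i + k) ` J') = card J + card J'"
    proof (subst card_Un_disjoint)
      show "finite J" "finite ((\<lambda>i. i + k) ` J')" using finite_subset[OF z(3)] finite_subset[OF z(5)] by auto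
      show "J \<inter> (\<lambda>i. i + k) ` J' = {}" by (auto dest: E_k J_less J'_pos)
      show "card J + card ((\<lambda>i. i + k) ` J') = card J + card J'"
        by (simp add: card_image)
    qed
    ultimately show ?case using z sub by simp
  qed auto
  also have "\<dots> = (\<Sum>q\<le>r. \<Sum>(J, J')\<in>?S (k-1) q \<times> ?S (n-k) (r-q). g J * h J')"
    using fin by (subst sum.Sigma) auto
  also have "\<dots> = (\<Sum>q\<le>r. (\<Sum>J\<in>?S (k-1) q. g J) * (\<Sum>J\<in>?S (n-k) (r-q). h J))"
    by (simp add: sum_product sum.cartesian_product)
  finally show ?thesis .
qed

text \<open>
  A sum over the rank sets rather than a mean: the binomial coefficients of a mean would spoil the
  convolutions in the recurrence.
\<close>

definition passes_gf :: "nat \<Rightarrow> nat \<Rightarrow> complex \<Rightarrow> complex" where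
  "passes_gf n p v = (\<Sum>I | I \<subseteq> {1..n} \<and> card I = p. rank_pgf n I v)"

lemma passes_gf_0 [simp]: "passes_gf n 0 v = 1"
proof -
  have "{I. I \<subseteq> {1..n} \<and> card I = 0} = {{}}"
    by (auto dest: finite_subset)
  thus ?thesis by (simp only: passes_gf_def) simp
qed

lemma passes_gf_empty: "p > 0 \<Longrightarrow> passes_gf 0 p v = 0"
  by (auto simp: passes_gf_def intro!: sum.neutral)

text \<open>
  The two convolutions belong to the pivot not being sought and being sought.
\<close>

lemma passes_gf_rec:
  assumes "p > 0"
  shows "of_nat (Suc n) * passes_gf (Suc n) p v =
    v * (\<Sum>k\<le>n. (\<Sum>q\<le>p. passes_gf k q v * passes_gf (n - k) (p - q) v) +
                 (\<Sum>q\<le>p-1. passes_gf k q v * passes_gf (n - k) (p - 1 - q) v))"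
proof -
  let ?S = "{I. I \<subseteq> {1..Suc n} \<and> card I = p}"
  have fin: "finite ?S" by (rule finite_subset[of _ "Pow {1..Suc n}"]) auto
  define T where "T = (\<lambda>k I. rank_pgf (k - 1) {i\<in>I. i < k} v *
                rank_pgf (Suc n - k) ((\<lambda>i. i - k) ` {i\<in>I. k < i}) v)"
  define G where "G = (\<lambda>k r. \<Sum>q\<le>r. passes_gf (k - 1) q v * passes_gf (Suc n - k) (r - q) v)"
  have T: "(\<Sum>I\<in>?S. T k I) = G k p + G k (p - 1)" if k: "k \<in> {1..Suc n}" for k
  proof -
    have "(\<Sum>I\<in>?S. T k I) = (\<Sum>I | I \<in> ?S \<and> k \<notin> I. T k I) + (\<Sum>I | I \<in> ?S \<and> k \<in> I. T k I)"
      using fin by (subst sum.union_disjoint [symmetric]) (auto intro!: sum.cong)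
    also have "{I. I \<in> ?S \<and> k \<notin> I} = {I. I \<subseteq> {1..Suc n} \<and> I \<inter> {k} = {} \<and> card (I - {k}) = p}"
      by (auto intro!: arg_cong[where f = card])
    also have "{I. I \<in> ?S \<and> k \<in> I} = {I. I \<subseteq> {1..Suc n} \<and> I \<inter> {k} = {k} \<and> card (I - {k}) = p - 1}"
    proof (intro Collect_cong iffI; safe?)
      fix I assume *: "I \<subseteq> {1..Suc n}" "I \<inter> {k} = {k}" "card (I - {k}) = p - 1"
      hence "finite I" "k \<in> I" by (auto dest: finite_subset)
      thus "card I = p" "k \<in> I" using *(3) assms card_Suc_Diff1[of I k] by auto
    qed (use assms in \<open>auto simp: card_Diff_singleton\<close>)
    also have "(\<Sum>I | I \<subseteq> {1..Suc n} \<and> I \<inter> {k} = {} \<and> card (I - {k}) = p. T k I) = G k p"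
      unfolding T_def G_def passes_gf_def by (rule sum_subsets_split[OF k]) auto
    also have "(\<Sum>I | I \<subseteq> {1..Suc n} \<and> I \<inter> {k} = {k} \<and> card (I - {k}) = p - 1. T k I) = G k (p - 1)"
      unfolding T_def G_def passes_gf_def by (rule sum_subsets_split[OF k]) auto
    finally show ?thesis .
  qed
  have "of_nat (Suc n) * passes_gf (Suc n) p v = (\<Sum>I\<in>?S. of_nat (Suc n) * rank_pgf (Suc n) I v)"
    by (simp add: passes_gf_def sum_distrib_left)
  also have "\<dots> = (\<Sum>I\<in>?S. v * (\<Sum>k=1..Suc n. T k I))"
  proof (intro sum.cong refl)
    fix I assume "I \<in> ?S"
    hence "I \<noteq> {}" using assms by auto
    thus "of_nat (Suc n) * rank_pgf (Suc n) I v = v * (\<Sum>k=1..Suc n. T k I)"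
      unfolding T_def by (intro rank_pgf_rec) auto
  qed
  also have "\<dots> = v * (\<Sum>k=1..Suc n. \<Sum>I\<in>?S. T k I)"
    unfolding sum_distrib_left [symmetric] by (subst sum.swap) simp
  also have "(\<Sum>k=1..Suc n. \<Sum>I\<in>?S. T k I) = (\<Sum>k=1..Suc n. G k p + G k (p - 1))"
    using T by (intro sum.cong) auto
  also have "\<dots> = (\<Sum>k\<le>n. G (Suc k) p + G (Suc k) (p - 1))"
    by (rule sum.reindex_bij_witness[of _ Suc "\<lambda>k. k - 1"]) auto
  finally show ?thesis by (simp add: G_def)
qed

lemma passes_gf_1: "passes_gf n p 1 = of_nat (n choose p)"
  using n_subsets[of "{1..n}" p] by (simp add: passes_gf_def rank_pgf_def)

lemma pgf_mqs_input:
  assumes "p \<le> n"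
  shows "measure_pmf.expectation (mqs_input n p) (\<lambda>(xs, I). v ^ mqs_passes xs I) =
         passes_gf n p v / of_nat (n choose p)"
proof -
  let ?S = "{I. I \<subseteq> {1..n} \<and> card I = p}"
  have fin: "finite ?S" by (rule finite_subset[of _ "Pow {1..n}"]) auto
  have card: "card ?S = n choose p" using n_subsets[of "{1..n}" p] by simp
  hence ne: "?S \<noteq> {}" using assms by (metis binomial_eq_0_iff card.empty not_less)
  have "mqs_input n p = pmf_of_set ?S \<bind> (\<lambda>I. map_pmf (\<lambda>xs. (xs, I)) (pmf_of_set (permutations_of_set {1..n})))"
    unfolding mqs_input_def pair_pmf_def map_pmf_def by (rule bind_commute_pmf)
  hence "measure_pmf.expectation (mqs_input n p) (\<lambda>(xs, I). v ^ mqs_passes xs I) =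
        (\<Sum>I\<in>?S. rank_pgf n I v /\<^sub>R real (card ?S))"
    using fin ne by (simp only:) (subst pmf_expectation_bind_pmf_of_set, auto simp: rank_pgf_def)
  thus ?thesis
    unfolding card by (simp add: passes_gf_def scaleR_conv_of_real sum_distrib_left divide_inverse mult_ac)
qed

section \<open>Uniform approximation of the generating functions\<close>

text \<open>
  Because the majorants convolve exactly, bounds for two sequences give a bound for their convolution
  without any loss.
\<close>

lemma convolution_bound:
  fixes f g :: "nat \<Rightarrow> complex"
  assumes f: "\<And>k. norm (f k) \<le> A * binc \<alpha> k" and g: "\<And>k. norm (g k) \<le> B * binc \<beta> k"
    and nonneg: "0 \<le> A" "0 \<le> \<alpha>"
  shows "norm (\<Sum>k\<le>n. f k * g (n - k)) \<le> A * B * binc (\<alpha> + \<beta>) n"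
proof -
  have "norm (\<Sum>k\<le>n. f k * g (n - k)) \<le> (\<Sum>k\<le>n. (A * binc \<alpha> k) * (B * binc \<beta> (n - k)))"
    by (intro sum_norm_le) 
       (auto simp: norm_mult nonneg binc_nonneg intro!: mult_mono f g)
  also have "\<dots> = A * B * (\<Sum>k\<le>n. binc \<alpha> k * binc \<beta> (n - k))"
    by (simp add: sum_distrib_left mult_ac)
  finally show ?thesis by (simp add: binc_convolution)
qed

text \<open>
  Separates the two terms that contain the unknown sequence itself from those with fewer sought ranks;
  what is left is a linear recurrence with a known inhomogeneity.
\<close>

lemma passes_gf_linear_rec:
  assumes "p > 0"
  shows "of_nat (Suc n) * passes_gf (Suc n) p v =
    2 * v * (\<Sum>k\<le>n. passes_gf k p v) + v *
      ((\<Sum>q\<in>{1..<p}. \<Sum>k\<le>n. passes_gf k q v * passes_gf (n - k) (p - q) v) +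
       (\<Sum>q<p. \<Sum>k\<le>n. passes_gf k q v * passes_gf (n - k) (p - 1 - q) v))"
proof -
  have *: "(\<Sum>q\<le>p. h q) = h 0 + h p + (\<Sum>q\<in>{1..<p}. h q)" for h :: "nat \<Rightarrow> complex"
  proof -
    have "{..p} = insert 0 (insert p {1..<p})" using assms by auto
    thus ?thesis using assms by simp
  qed
  have flip: "(\<Sum>k\<le>n. passes_gf (n - k) p v) = (\<Sum>k\<le>n. passes_gf k p v)"
    by (rule sum.reindex_bij_witness[of _ "\<lambda>k. n - k" "\<lambda>k. n - k"]) auto
  have "{..p-1} = {..<p}" using assms by auto
  thus ?thesis
    unfolding passes_gf_rec[OF assms] *
    by (simp add: sum.distrib flip sum.swap[of _ "{..n}"] algebra_simps)
qed

text \<open>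
  These constants are forced: comparing leading terms in the recurrence gives \<open>c\<^sub>1 = v/w\<close> and
  \<open>(p - 1) w c\<^sub>p = v \<Sum> c\<^sub>q c\<^sub>p\<^sub>-\<^sub>q\<close> over \<open>0 < q < p\<close>, with \<open>w = 2 v - 1\<close>. All products on the right are equal to
  \<open>(v/w)^(2p-2)\<close>.
\<close>

definition lead_const :: "nat \<Rightarrow> complex \<Rightarrow> complex" where
  "lead_const p v = (v / (2 * v - 1)) ^ (2 * p - 1)"

text \<open>
  For a single rank the recurrence has a closed solution. This starts the induction on the number of
  ranks. The induction step itself does not cover it: its stability argument needs an error exponent
  larger than \<open>2 |v|\<close>, and for one rank the exponent is close to 1.
\<close>

lemma passes_gf_one_rank:
  assumes "2 * v \<noteq> 1"
  shows "passes_gf n 1 v = lead_const 1 v * (binc (2 * v) n - 1)"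
proof (induction n rule: less_induct)
  case (less n)
  define c where "c = lead_const 1 v"
  have c: "c * (2 * v - 1) = v" using assms by (simp add: c_def lead_const_def)
  show ?case
  proof (cases n)
    case (Suc m)
    have "of_nat (Suc m) * passes_gf (Suc m) 1 v = 2 * v * (\<Sum>k\<le>m. passes_gf k 1 v) + v * of_nat (Suc m)"
      by (subst passes_gf_linear_rec) auto
    also have "(\<Sum>k\<le>m. passes_gf k 1 v) = (\<Sum>k\<le>m. c * (binc (2 * v) k - 1))"
      using less.IH Suc by (intro sum.cong) (auto simp: c_def)
    also have "\<dots> = c * (binc (2 * v + 1) m - of_nat (Suc m))"
      by (simp add: sum_distrib_left [symmetric] sum_subtractf binc_sum)
    also have "2 * v * \<dots> + v * of_nat (Suc m) = 
               c * (2 * v * binc (2 * v + 1) m) - (2 * v * c - v) * of_nat (Suc m)"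
      by (simp add: algebra_simps)
    also have "2 * v * c - v = c" using c by (simp add: algebra_simps)
    also have "2 * v * binc (2 * v + 1) m = of_nat (Suc m) * binc (2 * v) (Suc m)"
      by (rule binc_deriv [symmetric])
    finally have "of_nat (Suc m) * passes_gf (Suc m) 1 v = of_nat (Suc m) * (c * (binc (2 * v) (Suc m) - 1))"
      by (simp add: algebra_simps)
    thus ?thesis using Suc unfolding c_def mult_cancel_left by (simp del: of_nat_Suc)
  qed (simp add: passes_gf_empty)
qed

lemma lead_const_mult:
  assumes "1 \<le> q" "q < p"
  shows "lead_const q v * lead_const (p - q) v = (v / (2 * v - 1)) ^ (2 * p - 2)"
  unfolding lead_const_def power_add [symmetric] using assms
  by (intro arg_cong2[where f = power]) auto

lemma near_1_bounds:
  assumes "norm (v - 1) \<le> 1/4"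
  shows "norm v \<le> 5/4" "norm (v / (2 * v - 1)) \<le> 5/2" "2 * v - 1 \<noteq> 0"
    "norm (lead_const p v) \<le> (5/2) ^ (2 * p)"
proof -
  show v: "norm v \<le> 5/4" using norm_triangle_ineq[of "v - 1" 1] assms by simp
  have "norm (1 :: complex) \<le> norm (2 * v - 1) + norm (2 * (v - 1))"
    using norm_triangle_ineq4[of "2 * v - 1" "2 * (v - 1)"] by (simp add: algebra_simps)
  moreover have "norm (2 * (v - 1)) = 2 * norm (v - 1)" unfolding norm_mult by simp
  ultimately have w: "norm (2 * v - 1) \<ge> 1/2" using assms by (simp only: norm_one)
  thus "2 * v - 1 \<noteq> 0" by auto
  have "norm v / norm (2 * v - 1) \<le> (5/4) / (1/2)"
    by (intro frac_le v w) auto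
  thus r: "norm (v / (2 * v - 1)) \<le> 5/2" by (simp add: norm_divide)
  have "norm (lead_const p v) \<le> (5/2) ^ (2 * p - 1)"
    unfolding lead_const_def norm_power by (intro power_mono r) auto
  also have "\<dots> \<le> (5/2) ^ (2 * p)" by (intro power_increasing) auto
  finally show "norm (lead_const p v) \<le> (5/2) ^ (2 * p)" .
qed

text \<open>
  In the inhomogeneity, every product of two main terms contributes the same multiple of
  \<open>(1 - z)^(-2-pw)\<close>, and these are exactly matched by the main term for \<open>p\<close>; every other product contains an
  error term or one rank less and is majorized by \<open>(1 - z)^(-a-1)\<close> with \<open>a = p + 2 \<theta>\<close>. The error thus
  solves \<open>e' = 2 v e / (1 - z) + O((1 - z)^(-a-1))\<close>. Since the derivative of \<open>(1 - z)^(-a)\<close> brings down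
  a factor \<open>a > 2 |v|\<close>, a sufficiently large multiple of \<open>(1 - z)^(-a)\<close> is preserved as a majorant.
\<close>

lemma passes_gf_error_step:
  assumes p: "p \<ge> 2" and \<theta>: "\<theta> > 0" and K: "K \<ge> 0" and v: "norm (v - 1) \<le> \<delta>"
    and \<delta>: "\<delta> \<le> 1/4" "2 * real p * \<delta> \<le> \<theta>"
    and IH: "\<And>q n. 1 \<le> q \<Longrightarrow> q < p \<Longrightarrow>
      norm (passes_gf n q v - lead_const q v * binc (1 + of_nat q * (2 * v - 1)) n) \<le> K * binc (real q + \<theta>) n"
  defines "C \<equiv> (5/2) ^ (2 * p)"
  defines "D \<equiv> C + K"
  defines "K1 \<equiv> real p * (2 * K * D) + real p * D\<^sup>2"
  shows "norm (passes_gf n p v - lead_const p v * binc (1 + of_nat p * (2 * v - 1)) n)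
           \<le> (C + 5 * K1 / \<theta>) * binc (real p + 2 * \<theta>) n"
proof -
  define w where "w = 2 * v - 1"
  define c where "c = (\<lambda>q. lead_const q v)"
  define F where "F = (\<lambda>q n. passes_gf n q v)"
  define e where "e = (\<lambda>q n. F q n - c q * binc (1 + of_nat q * w) n)"
  define K2 where "K2 = C + 5 * K1 / \<theta>"
  define a where "a = real p + 2 * \<theta>"
  have v': "norm (v - 1) \<le> 1/4" using v \<delta> by simp
  note b = near_1_bounds[OF v']
  have C1: "C \<ge> 1" unfolding C_def by (intro one_le_power) auto
  have D1: "D \<ge> 1" using C1 K by (simp add: D_def)
  have cC: "norm (c q) \<le> C" if "q \<le> p" for q
  proof -
    have "norm (c q) \<le> (5/2) ^ (2 * q)" unfolding c_def by (rule b(4))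
    also have "\<dots> \<le> C" unfolding C_def using that by (intro power_increasing) auto
    finally show ?thesis .
  qed
  have main: "norm (c q * binc (1 + of_nat q * w) n) \<le> C * binc (1 + real q + \<theta>) n" if "q \<le> p" for q n
  proof -
    have "norm (1 + of_nat q * w) = norm (1 + of_nat q + of_nat q * (2 * (v - 1)))"
      by (simp add: w_def algebra_simps)
    also have "\<dots> \<le> norm (1 + of_nat q :: complex) + norm (of_nat q * (2 * (v - 1)))"
      by (rule norm_triangle_ineq)
    also have "\<dots> = (1 + real q) + 2 * real q * norm (v - 1)"
    proof -
      have "norm (1 + of_nat q :: complex) = 1 + real q" by (simp flip: of_nat_Suc)
      thus ?thesis by (simp only: norm_mult) simp
    qed
    also have "2 * real q * norm (v - 1) \<le> 2 * real p * \<delta>"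
      using that v by (intro mult_mono) auto
    also have "\<dots> \<le> \<theta>" by fact
    finally have "norm (binc (1 + of_nat q * w) n) \<le> binc (1 + real q + \<theta>) n"
      by (intro norm_binc_le) simp
    thus ?thesis
      unfolding norm_mult using cC[OF that] C1 by (intro mult_mono) auto
  qed
  have eK: "norm (e q n) \<le> K * binc (real q + \<theta>) n" if "1 \<le> q" "q < p" for q n
    using IH[OF that, of n] by (simp add: e_def F_def c_def w_def)
  have FD: "norm (F q n) \<le> D * binc (1 + real q + \<theta>) n" if "q < p" for q n
  proof (cases "q = 0")
    case True
    thus ?thesis using mult_mono[of 1 D 1 "binc (1 + \<theta>) n"] D1 binc_ge_1[of "1 + \<theta>" n] \<theta>
      by (simp add: F_def)
  next
    case False
    have "norm (F q n) \<le> norm (c q * binc (1 + of_nat q * w) n) + norm (e q n)"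
      unfolding e_def by (rule norm_triangle_sub)
    also have "\<dots> \<le> C * binc (1 + real q + \<theta>) n + K * binc (real q + \<theta>) n"
      using False that by (intro add_mono main eK) auto
    also have "K * binc (real q + \<theta>) n \<le> K * binc (1 + real q + \<theta>) n"
      using \<theta> K by (intro mult_left_mono binc_mono) auto
    finally show ?thesis by (simp add: D_def algebra_simps)
  qed
  have conv1: "norm ((\<Sum>k\<le>n. F q k * F (p - q) (n - k)) - (v / w) ^ (2 * p - 2) * binc (2 + of_nat p * w) n)
                \<le> 2 * K * D * binc (a + 1) n" if q: "q \<in> {1..<p}" for q n
  proof -
    let ?m = "\<lambda>q n. c q * binc (1 + of_nat q * w) n"
    have "(\<Sum>k\<le>n. ?m q k * ?m (p - q) (n - k)) = 
          c q * c (p - q) * (\<Sum>k\<le>n. binc (1 + of_nat q * w) k * binc (1 + of_nat (p - q) * w) (n - k))"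
      by (simp add: sum_distrib_left mult_ac)
    also have "\<dots> = (v / w) ^ (2 * p - 2) * binc ((1 + of_nat q * w) + (1 + of_nat (p - q) * w)) n"
      using q by (simp add: binc_convolution c_def lead_const_mult w_def)
    also have "(1 + of_nat q * w) + (1 + of_nat (p - q) * w) = 2 + of_nat p * w"
      using q by (simp add: of_nat_diff algebra_simps)
    finally have "(\<Sum>k\<le>n. F q k * F (p - q) (n - k)) - (v / w) ^ (2 * p - 2) * binc (2 + of_nat p * w) n
       = (\<Sum>k\<le>n. F q k * F (p - q) (n - k) - ?m q k * ?m (p - q) (n - k))"
      by (simp add: sum_subtractf)
    also have "\<dots> = (\<Sum>k\<le>n. e q k * F (p - q) (n - k)) + (\<Sum>k\<le>n. ?m q k * e (p - q) (n - k))"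
      unfolding sum.distrib [symmetric] by (intro sum.cong refl) (simp add: e_def algebra_simps)
    also have "norm \<dots> \<le> K * D * binc ((real q + \<theta>) + (1 + real (p - q) + \<theta>)) n +
                        C * K * binc ((1 + real q + \<theta>) + (real (p - q) + \<theta>)) n"
      using q K C1 \<theta> by (intro order.trans[OF norm_triangle_ineq] add_mono convolution_bound eK FD main) auto
    also have "(real q + \<theta>) + (1 + real (p - q) + \<theta>) = a + 1"
      using q by (simp add: a_def of_nat_diff)
    also have "(1 + real q + \<theta>) + (real (p - q) + \<theta>) = a + 1"
      using q by (simp add: a_def of_nat_diff)
    also have "C * K * binc (a + 1) n \<le> K * D * binc (a + 1) n"
      using K \<theta> by (intro mult_right_mono binc_nonneg) (auto simp: a_def D_def algebra_simps)
    finally show ?thesis by (simp add: algebra_simps)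
  qed
  have conv2: "norm (\<Sum>k\<le>n. F q k * F (p - 1 - q) (n - k)) \<le> D\<^sup>2 * binc (a + 1) n" if q: "q < p" for q n
  proof -
    have "norm (\<Sum>k\<le>n. F q k * F (p - 1 - q) (n - k)) \<le> 
            D * D * binc ((1 + real q + \<theta>) + (1 + real (p - 1 - q) + \<theta>)) n"
      using q D1 \<theta> by (intro convolution_bound FD) auto
    also have "(1 + real q + \<theta>) + (1 + real (p - 1 - q) + \<theta>) = a + 1"
      using q by (simp add: a_def of_nat_diff)
    finally show ?thesis by (simp add: power2_eq_square)
  qed
  define r where "r = (\<lambda>n. (\<Sum>q\<in>{1..<p}. (\<Sum>k\<le>n. F q k * F (p - q) (n - k)) - (v / w) ^ (2 * p - 2) * binc (2 + of_nat p * w) n)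
                    + (\<Sum>q<p. \<Sum>k\<le>n. F q k * F (p - 1 - q) (n - k)))"
  have r: "norm (r n) \<le> K1 * binc (a + 1) n" for n
  proof -
    have "norm (r n) \<le> (\<Sum>q\<in>{1..<p}. 2 * K * D * binc (a + 1) n) + (\<Sum>q<p. D\<^sup>2 * binc (a + 1) n)"
      unfolding r_def
      by (intro order.trans[OF norm_triangle_ineq] add_mono sum_norm_le conv1 conv2) auto
    also have "\<dots> \<le> real p * (2 * K * D * binc (a + 1) n) + real p * (D\<^sup>2 * binc (a + 1) n)"
      using K D1 \<theta> by (simp add: binc_nonneg a_def mult_right_mono)
    finally show ?thesis by (simp add: K1_def algebra_simps)
  qed
  have K1: "K1 \<ge> 0" using K D1 by (simp add: K1_def)
  have K2: "K2 \<ge> 0" using K1 C1 \<theta> by (simp add: K2_def)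
  have rec: "of_nat (Suc n) * e p (Suc n) = 2 * v * (\<Sum>k\<le>n. e p k) + v * r n" for n
  proof -
    define B where "B = binc (2 + of_nat p * w) n"
    define s where "s = (\<Sum>q\<in>{1..<p}. \<Sum>k\<le>n. F q k * F (p - q) (n - k)) + (\<Sum>q<p. \<Sum>k\<le>n. F q k * F (p - 1 - q) (n - k))"
    have rs: "r n = s - of_nat (p - 1) * (v / w) ^ (2 * p - 2) * B"
      by (simp add: r_def s_def B_def sum_subtractf)
    have F: "of_nat (Suc n) * F p (Suc n) = 2 * v * (\<Sum>k\<le>n. F p k) + v * s"
      unfolding F_def s_def using p by (intro passes_gf_linear_rec) auto
    have m1: "of_nat (Suc n) * binc (1 + of_nat p * w) (Suc n) = (1 + of_nat p * w) * B"
      by (subst binc_deriv) (simp add: B_def algebra_simps)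
    have m2: "(\<Sum>k\<le>n. c p * binc (1 + of_nat p * w) k) = c p * B"
      by (simp add: binc_sum B_def sum_distrib_left [symmetric] algebra_simps)
    have "c p = (v / w) ^ Suc (2 * p - 2)"
      unfolding c_def lead_const_def w_def using p by (intro arg_cong2[where f = power]) auto
    hence cp: "c p * w = v * (v / w) ^ (2 * p - 2)" using b(3) by (simp add: w_def)
    have "of_nat (Suc n) * e p (Suc n) = of_nat (Suc n) * F p (Suc n) - 
             c p * (of_nat (Suc n) * binc (1 + of_nat p * w) (Suc n))"
      by (simp add: e_def algebra_simps)
    also have "\<dots> = 2 * v * (\<Sum>k\<le>n. F p k) + v * s - c p * (1 + of_nat p * w) * B"
      unfolding F m1 by (simp add: algebra_simps)
    also have "(\<Sum>k\<le>n. F p k) = (\<Sum>k\<le>n. e p k) + c p * B"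
      unfolding m2 [symmetric] sum.distrib [symmetric] by (simp add: e_def)
    also have "v * s = v * r n + of_nat (p - 1) * (v * (v / w) ^ (2 * p - 2)) * B"
      unfolding rs by (simp add: algebra_simps)
    finally show ?thesis
      unfolding cp [symmetric] using p by (simp add: w_def of_nat_diff algebra_simps)
  qed
  have "norm (e p n) \<le> K2 * binc a n"
  proof (induction n rule: less_induct)
    case (less n)
    show ?case
    proof (cases n)
      case 0
      have "norm (e p 0) = norm (c p)" using p by (simp add: e_def F_def passes_gf_empty)
      also have "\<dots> \<le> K2" using cC[of p] K1 \<theta> by (simp add: K2_def add_increasing2)
      finally show ?thesis using 0 by simp
    next
      case (Suc m)
      have sum_e: "norm (\<Sum>k\<le>m. e p k) \<le> K2 * binc (a + 1) m"
      proof -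
        have "norm (\<Sum>k\<le>m. e p k) \<le> (\<Sum>k\<le>m. K2 * binc a k)"
          using Suc by (intro sum_norm_le less.IH) auto
        thus ?thesis by (simp add: binc_sum sum_distrib_left [symmetric])
      qed
      have nv: "norm v \<le> 1 + \<delta>" using norm_triangle_ineq[of "v - 1" 1] v by simp
      have \<delta>0: "\<delta> \<ge> 0" using v norm_ge_zero[of "v - 1"] by linarith
      have "4 * \<delta> \<le> 2 * real p * \<delta>" using p \<delta>0 by (intro mult_right_mono) auto
      hence \<delta>4: "2 * \<delta> \<le> \<theta>" using \<delta> \<delta>0 by linarith
      have "real (Suc m) * norm (e p (Suc m)) = norm (2 * v * (\<Sum>k\<le>m. e p k) + v * r m)"
        unfolding rec [symmetric] by (simp add: norm_mult del: of_nat_Suc)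
      also have "\<dots> \<le> 2 * norm v * norm (\<Sum>k\<le>m. e p k) + norm v * norm (r m)"
        by (rule order.trans[OF norm_triangle_ineq]) (simp add: norm_mult)
      also have "\<dots> \<le> 2 * (1 + \<delta>) * (K2 * binc (a + 1) m) + (5/4) * (K1 * binc (a + 1) m)"
        using nv b(1) sum_e r[of m] \<delta>0 by (intro add_mono mult_mono) (auto intro: order.trans[OF norm_ge_zero])
      also have "\<dots> = (2 * (1 + \<delta>) * K2 + 5/4 * K1) * binc (a + 1) m"
        by (simp add: algebra_simps)
      also have "\<dots> \<le> (a * K2) * binc (a + 1) m"
      proof (rule mult_right_mono)
        \<comment> \<open>half of the surplus \<open>2 \<theta>\<close> of \<open>a\<close> absorbs \<open>\<delta>\<close>, the other half the inhomogeneity\<close>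
        have "5 * K1 \<le> \<theta> * K2" using \<theta> C1 by (simp add: K2_def field_simps)
        moreover have "(2 * \<delta>) * K2 \<le> \<theta> * K2" using \<delta>4 K2 by (intro mult_right_mono)
        moreover have "2 * K2 \<le> real p * K2" using p K2 by (intro mult_right_mono) auto
        ultimately show "2 * (1 + \<delta>) * K2 + 5/4 * K1 \<le> a * K2"
          using K1 unfolding a_def by (simp add: algebra_simps)
      qed (use \<theta> in \<open>auto simp: a_def intro!: binc_nonneg\<close>)
      also have "\<dots> = real (Suc m) * (K2 * binc a (Suc m))"
        using binc_deriv[of m a] by (simp add: algebra_simps)
      finally have "norm (e p (Suc m)) \<le> K2 * binc a (Suc m)"
        by (rule mult_left_le_imp_le) simp
      thus ?thesis using Suc by simp
    qed
  qed
  thus ?thesis by (simp add: e_def F_def c_def w_def K2_def a_def)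
qed

text \<open>
  Each induction step doubles the excess \<open>\<theta>\<close> in the exponent, so the hypothesis is used with \<open>\<theta>/2\<close>.
\<close>

lemma passes_gf_asymptotics_upto:
  assumes "\<theta> > 0"
  shows "\<exists>\<delta>>0. \<exists>K\<ge>0. \<delta> \<le> 1/4 \<and> (\<forall>v q n. norm (v - 1) \<le> \<delta> \<longrightarrow> 1 \<le> q \<longrightarrow> q \<le> p \<longrightarrow>
    norm (passes_gf n q v - lead_const q v * binc (1 + of_nat q * (2 * v - 1)) n) \<le> K * binc (real q + \<theta>) n)"
  using assms
proof (induction p arbitrary: \<theta>)
  case 0
  thus ?case by (intro exI[of _ "1/4"] exI[of _ 0]) auto
next
  case (Suc p)
  define \<eta> where "\<eta> = \<theta> / 2"
  have \<eta>: "\<eta> > 0" "\<theta> = 2 * \<eta>" using Suc.prems by (auto simp: \<eta>_def)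
  obtain \<delta> K where IH: "\<delta> > 0" "K \<ge> 0" "\<delta> \<le> 1/4" and
    bound: "\<And>v q n. norm (v - 1) \<le> \<delta> \<Longrightarrow> 1 \<le> q \<Longrightarrow> q \<le> p \<Longrightarrow>
    norm (passes_gf n q v - lead_const q v * binc (1 + of_nat q * (2 * v - 1)) n) \<le> K * binc (real q + \<eta>) n"
    using Suc.IH[OF \<eta>(1)] by blast
  define \<delta>' where "\<delta>' = min \<delta> (\<eta> / (2 * real (Suc p)))"
  have "2 * real (Suc p) * \<delta>' \<le> 2 * real (Suc p) * (\<eta> / (2 * real (Suc p)))"
    unfolding \<delta>'_def by (intro mult_left_mono) auto
  moreover have "\<delta>' \<le> \<delta>" by (simp add: \<delta>'_def)
  moreover have "\<delta>' \<le> 1/4" using \<open>\<delta>' \<le> \<delta>\<close> IH by linarith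
  moreover have "\<delta>' > 0" using IH \<eta> by (simp add: \<delta>'_def del: of_nat_Suc)
  ultimately have \<delta>': "\<delta>' > 0" "\<delta>' \<le> \<delta>" "\<delta>' \<le> 1/4" "2 * real (Suc p) * \<delta>' \<le> \<eta>"
    using \<eta> by (simp_all del: of_nat_Suc)
  define L where "L = (5/2 :: real) ^ (2 * Suc p)"
  define M where "M = L + 5 * (real (Suc p) * (2 * K * (L + K)) + real (Suc p) * (L + K)\<^sup>2) / \<eta>"
  have L: "L \<ge> 0" "M \<ge> L" using IH \<eta> by (auto simp: L_def M_def intro!: divide_nonneg_pos add_nonneg_nonneg mult_nonneg_nonneg)
  have bound': "\<forall>v q n. norm (v - 1) \<le> \<delta>' \<longrightarrow> 1 \<le> q \<longrightarrow> q \<le> Suc p \<longrightarrow>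
    norm (passes_gf n q v - lead_const q v * binc (1 + of_nat q * (2 * v - 1)) n) \<le> max K M * binc (real q + \<theta>) n"
  proof (intro allI impI)
    fix v :: complex and q n :: nat
    assume v: "norm (v - 1) \<le> \<delta>'" and q: "1 \<le> q" "q \<le> Suc p"
    have nonneg: "binc (real q + \<theta>) n \<ge> 0" using Suc.prems by (intro binc_nonneg) auto
    consider "q \<le> p" | "q = Suc p" "p = 0" | "q = Suc p" "p \<ge> 1" using q by linarith
    thus "norm (passes_gf n q v - lead_const q v * binc (1 + of_nat q * (2 * v - 1)) n)
            \<le> max K M * binc (real q + \<theta>) n"
    proof cases
      case 1
      have "norm (passes_gf n q v - lead_const q v * binc (1 + of_nat q * (2 * v - 1)) n) \<le> K * binc (real q + \<eta>) n"
        using v \<delta>' q 1 by (intro bound) auto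
      also have "\<dots> \<le> max K M * binc (real q + \<theta>) n"
        using IH \<eta> by (intro mult_mono binc_mono binc_nonneg) auto
      finally show ?thesis .
    next
      case 2
      have v': "norm (v - 1) \<le> 1/4" using v \<delta>' by simp
      note b = near_1_bounds[OF v']
      have "passes_gf n 1 v - lead_const 1 v * binc (1 + of_nat 1 * (2 * v - 1)) n = - lead_const 1 v"
        by (subst passes_gf_one_rank) (use b(3) in \<open>auto simp: algebra_simps\<close>)
      hence "norm (passes_gf n q v - lead_const q v * binc (1 + of_nat q * (2 * v - 1)) n) = norm (lead_const 1 v)"
        using 2 by simp
      also have "\<dots> \<le> L" unfolding L_def 2 using b(4)[of 1] by simp
      also have "\<dots> \<le> max K M * 1" using L by simp
      also have "\<dots> \<le> max K M * binc (real q + \<theta>) n"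
        using L Suc.prems q by (intro mult_left_mono binc_ge_1) auto
      finally show ?thesis .
    next
      case 3
      have "norm (passes_gf n (Suc p) v - lead_const (Suc p) v * binc (1 + of_nat (Suc p) * (2 * v - 1)) n)
              \<le> M * binc (real (Suc p) + 2 * \<eta>) n"
        unfolding M_def L_def using 3 v \<delta>' IH \<eta>
        by (intro passes_gf_error_step[where \<delta> = \<delta>'] bound) (auto intro: order.trans[OF v])
      also have "\<dots> \<le> max K M * binc (real q + \<theta>) n"
        unfolding 3 \<eta>(2) [symmetric] using nonneg 3 by (intro mult_right_mono) auto
      finally show ?thesis using 3 by simp
    qed
  qed
  have "max K M \<ge> 0" using IH by simp
  show ?case
    by (rule exI[of _ \<delta>'], intro conjI, fact, rule exI[of _ "max K M"], intro conjI) fact+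
qed

text \<open>
  The main term, normalised to have value 1 at \<open>v = 1\<close>.
\<close>

definition main_pgf :: "nat \<Rightarrow> nat \<Rightarrow> complex \<Rightarrow> complex" where
  "main_pgf p n v = lead_const p v * (\<Prod>k=1..n. 1 + of_real (2 * real p / real (p + k)) * (v - 1))"

lemma main_pgf_1 [simp]: "main_pgf p n 1 = 1"
  by (simp add: main_pgf_def lead_const_def)

lemma lead_term_eq_main_pgf:
  "lead_const p v * binc (1 + of_nat p * (2 * v - 1)) n = of_real (binc (1 + real p) n) * main_pgf p n v"
proof -
  have "(\<Prod>i<n. 1 + of_nat p * (2 * v - 1) + of_nat i) =
        (\<Prod>i<n. of_real (1 + real p + real i) * (1 + of_real (2 * real p / real (p + Suc i)) * (v - 1)))"
  proof (intro prod.cong refl)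
    fix i
    have "of_nat (p + Suc i) \<noteq> (0::complex)" by (simp del: of_nat_Suc of_nat_add add_Suc_right)
    thus "1 + of_nat p * (2 * v - 1) + of_nat i =
        of_real (1 + real p + real i) * (1 + of_real (2 * real p / real (p + Suc i)) * (v - 1))"
      by (simp add: field_simps)
  qed
  also have "\<dots> = of_real (\<Prod>i<n. 1 + real p + real i) * (\<Prod>i<n. 1 + of_real (2 * real p / real (p + Suc i)) * (v - 1))"
    by (simp add: prod.distrib)
  also have "(\<Prod>i<n. 1 + of_real (2 * real p / real (p + Suc i)) * (v - 1)) =
             (\<Prod>k=1..n. 1 + of_real (2 * real p / real (p + k)) * (v - 1))"
    by (rule prod.reindex_bij_witness[of _ "\<lambda>k. k - 1" Suc]) auto
  finally show ?thesis
    by (simp add: binc_def pochhammer_prod atLeast0LessThan main_pgf_def mult_ac)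
qed

lemma binc_le_powr:
  assumes "a \<ge> 1" "n > 0"
  shows "binc a n \<le> exp (a - 1) * real n powr (a - 1)"
proof -
  have "binc a n = (\<Prod>i<n. 1 + (a - 1) / real (Suc i))"
  proof -
    have "binc a n = (\<Prod>i<n. a + real i) / (\<Prod>i<n. real (Suc i))"
      by (simp add: binc_def pochhammer_prod fact_prod_Suc atLeast0LessThan)
    also have "\<dots> = (\<Prod>i<n. (a + real i) / real (Suc i))" by (rule prod_dividef [symmetric])
    finally show ?thesis by (simp add: field_simps)
  qed
  also have "\<dots> \<le> (\<Prod>i<n. exp ((a - 1) / real (Suc i)))"
    using assms by (intro prod_mono conjI exp_ge_add_one_self) auto
  also have "\<dots> = exp ((a - 1) * (\<Sum>i<n. 1 / real (Suc i)))"
    by (simp add: exp_sum sum_distrib_left)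
  also have "(\<Sum>i<n. 1 / real (Suc i)) = harm n"
    unfolding harm_def by (rule sum.reindex_bij_witness[of _ "\<lambda>k. k - 1" Suc]) (auto simp: inverse_eq_divide)
  also have "harm n \<le> 1 + ln (real n)"
    using euler_mascheroni_sequence_decreasing[of 1 n] assms by (simp add: harm_def)
  hence "exp ((a - 1) * harm n) \<le> exp ((a - 1) * (1 + ln (real n)))"
    using assms by (simp add: mult_left_mono)
  also have "\<dots> = exp (a - 1) * real n powr (a - 1)"
  proof -
    have "(a - 1) * (1 + ln (real n)) = (a - 1) + (a - 1) * ln (real n)" by (simp add: algebra_simps)
    thus ?thesis using assms by (simp only: exp_add powr_def) simp
  qed
  finally show ?thesis .
qed

lemma norm_main_pgf_le:
  assumes "norm (v - 1) \<le> \<delta>" "\<delta> \<le> 1/4" "2 * real p * \<delta> \<le> \<theta>" "n > 0"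
  shows "norm (main_pgf p n v) \<le> (5/2) ^ (2 * p) * (exp \<theta> * real n powr \<theta>)"
proof -
  have \<delta>: "\<delta> \<ge> 0" using assms(1) norm_ge_zero[of "v - 1"] by linarith
  have \<theta>: "\<theta> \<ge> 0" using assms(3) \<delta> order.trans[of 0 "2 * real p * \<delta>" \<theta>] by simp
  have "norm (\<Prod>k=1..n. 1 + of_real (2 * real p / real (p + k)) * (v - 1)) \<le> (\<Prod>k=1..n. 1 + \<theta> / real k)"
    unfolding prod_norm[symmetric]
  proof (intro prod_mono conjI)
    fix k assume k: "k \<in> {1..n}"
    have "norm (1 + of_real (2 * real p / real (p + k)) * (v - 1)) \<le> 1 + 2 * real p / real (p + k) * norm (v - 1)"
      by (rule order.trans[OF norm_triangle_ineq]) (simp only: norm_mult norm_of_real norm_one, simp)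
    also have "2 * real p / real (p + k) * norm (v - 1) \<le> 2 * real p / real k * \<delta>"
      using k assms by (intro mult_mono divide_left_mono) auto
    also have "\<dots> = (2 * real p * \<delta>) / real k" by simp
    also have "\<dots> \<le> \<theta> / real k" using assms by (intro divide_right_mono) auto
    finally show "norm (1 + of_real (2 * real p / real (p + k)) * (v - 1)) \<le> 1 + \<theta> / real k" by simp
  qed auto
  also have "(\<Prod>k=1..n. 1 + \<theta> / real k) = binc (1 + \<theta>) n"
  proof -
    have "binc (1 + \<theta>) n = (\<Prod>i<n. 1 + \<theta> + real i) / (\<Prod>i<n. real (Suc i))"
      by (simp add: binc_def pochhammer_prod fact_prod_Suc atLeast0LessThan)
    also have "\<dots> = (\<Prod>i<n. (1 + \<theta> + real i) / real (Suc i))" by (rule prod_dividef [symmetric])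
    also have "\<dots> = (\<Prod>k=1..n. 1 + \<theta> / real k)"
      by (rule prod.reindex_bij_witness[of _ "\<lambda>k. k - 1" Suc]) (auto simp: field_simps)
    finally show ?thesis ..
  qed
  also have "binc (1 + \<theta>) n \<le> exp \<theta> * real n powr \<theta>"
    using binc_le_powr[of "1 + \<theta>" n] \<theta> assms by simp
  finally show ?thesis unfolding main_pgf_def norm_mult
    using near_1_bounds(4)[of v p] assms by (intro mult_mono) auto
qed

definition passes_pgf :: "nat \<Rightarrow> nat \<Rightarrow> complex \<Rightarrow> complex" where
  "passes_pgf p n v = passes_gf n p v / of_nat (n choose p)"

text \<open>
  The quotient of \<open>binc (1 + p) n\<close> and \<open>n choose p\<close> has to be replaced by 1. That it is close enough to 1
  is the estimate for the generating functions at \<open>v = 1\<close>, where both sides are known.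
\<close>

lemma passes_pgf_approx:
  assumes p: "p \<ge> 1" and \<epsilon>: "\<epsilon> > 0"
  shows "\<exists>\<delta>>0. \<exists>K>0. \<delta> \<le> 1/4 \<and> (\<forall>n\<ge>p. \<forall>v. norm (v - 1) \<le> \<delta> \<longrightarrow>
           norm (passes_pgf p n v - main_pgf p n v) \<le> K * real n powr (\<epsilon> - 1))"
proof -
  define \<theta> where "\<theta> = \<epsilon> / 2"
  have \<theta>: "\<theta> > 0" "\<epsilon> = \<theta> + \<theta>" using \<epsilon> by (auto simp: \<theta>_def)
  obtain \<delta>0 K where IH: "\<delta>0 > 0" "K \<ge> 0" "\<delta>0 \<le> 1/4" and
    bound: "\<And>v q n. norm (v - 1) \<le> \<delta>0 \<Longrightarrow> 1 \<le> q \<Longrightarrow> q \<le> p \<Longrightarrow>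
    norm (passes_gf n q v - lead_const q v * binc (1 + of_nat q * (2 * v - 1)) n) \<le> K * binc (real q + \<theta>) n"
    using passes_gf_asymptotics_upto[OF \<theta>(1), of p] by blast
  define \<delta> where "\<delta> = min \<delta>0 (\<theta> / (2 * real p))"
  have "2 * real p * \<delta> \<le> 2 * real p * (\<theta> / (2 * real p))"
    unfolding \<delta>_def by (intro mult_left_mono) auto
  also have "\<dots> = \<theta>" using p by simp
  finally have \<delta>: "2 * real p * \<delta> \<le> \<theta>" .
  have \<delta>': "\<delta> > 0" "\<delta> \<le> \<delta>0" using IH \<theta> p by (auto simp: \<delta>_def)
  have \<delta>4: "\<delta> \<le> 1/4" using \<delta>' IH by linarith
  define C where "C = K * exp (real p - 1 + \<theta>) * real p ^ p"
  have C: "C \<ge> 0" using IH by (simp add: C_def)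
  define L where "L = C + C * ((5/2) ^ (2 * p) * exp \<theta>) + 1"
  have L: "L > 0" using C by (simp add: L_def add_nonneg_pos)
  have main: "norm (passes_pgf p n v - main_pgf p n v) \<le> L * real n powr (\<epsilon> - 1)"
    if n: "n \<ge> p" and v: "norm (v - 1) \<le> \<delta>" for n v
  proof -
    have n0: "n > 0" using n p by simp
    define b where "b = real (n choose p)"
    have b0: "b > 0" using n by (simp add: b_def)
    have err: "norm (passes_gf n p u - lead_const p u * binc (1 + of_nat p * (2 * u - 1)) n) / b \<le> C * real n powr (\<theta> - 1)"
      if "norm (u - 1) \<le> \<delta>" for u
    proof -
      have "norm (passes_gf n p u - lead_const p u * binc (1 + of_nat p * (2 * u - 1)) n) \<le> K * binc (real p + \<theta>) n"
        using that \<delta>' p by (intro bound) auto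
      also have "\<dots> \<le> K * (exp (real p - 1 + \<theta>) * real n powr (real p - 1 + \<theta>))"
        using binc_le_powr[of "real p + \<theta>" n] p n0 \<theta> IH by (intro mult_left_mono) (auto simp: algebra_simps)
      finally have 1: "norm (passes_gf n p u - lead_const p u * binc (1 + of_nat p * (2 * u - 1)) n)
        \<le> K * (exp (real p - 1 + \<theta>) * real n powr (real p - 1 + \<theta>))" .
      have 2: "(real n / real p) ^ p \<le> b"
        unfolding b_def by (rule binomial_ge_n_over_k_pow_k[OF n])
      have pos: "(real n / real p) ^ p > 0" using p n0 by simp
      have "norm (passes_gf n p u - lead_const p u * binc (1 + of_nat p * (2 * u - 1)) n) / b
          \<le> K * (exp (real p - 1 + \<theta>) * real n powr (real p - 1 + \<theta>)) / (real n / real p) ^ p"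
        using 1 2 pos IH by (intro frac_le) auto
      also have "\<dots> = C * (real n powr (real p - 1 + \<theta>) / real n ^ p)"
        using p by (simp add: C_def power_divide field_simps)
      also have "real n powr (real p - 1 + \<theta>) / real n ^ p = real n powr (\<theta> - 1)"
      proof -
        have "real n powr (\<theta> - 1) * real n ^ p = real n powr (real p - 1 + \<theta>)"
          using n0 by (simp add: powr_realpow [symmetric] powr_add [symmetric] algebra_simps)
        thus ?thesis using n0 by (simp add: field_simps)
      qed
      finally show ?thesis .
    qed
    define B where "B = binc (1 + real p) n"
    have "norm (of_real b - of_real B :: complex) / b \<le> C * real n powr (\<theta> - 1)"
    proof -
      have "binc (1 + of_nat p * (2 * 1 - 1)) n = (of_real B :: complex)"
        using lead_term_eq_main_pgf[of p 1 n] by (simp add: lead_const_def B_def)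
      thus ?thesis using err[of 1] \<delta>' by (simp add: passes_gf_1 b_def lead_const_def)
    qed
    hence ratio: "\<bar>B / b - 1\<bar> \<le> C * real n powr (\<theta> - 1)"
    proof -
      have "norm (of_real b - of_real B :: complex) = \<bar>B - b\<bar>"
        by (simp only: of_real_diff [symmetric] norm_of_real abs_minus_commute)
      moreover have "\<bar>B - b\<bar> / b = \<bar>B / b - 1\<bar>" using b0 by (simp add: field_simps abs_if)
      ultimately show ?thesis using \<open>norm _ / b \<le> _\<close> by simp
    qed
    have "passes_pgf p n v - main_pgf p n v =
          (passes_gf n p v - of_real B * main_pgf p n v) / of_real b + of_real (B / b - 1) * main_pgf p n v"
      using b0 by (simp add: passes_pgf_def b_def field_simps)
    also have "norm \<dots> \<le> norm (passes_gf n p v - of_real B * main_pgf p n v) / b + \<bar>B / b - 1\<bar> * norm (main_pgf p n v)"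
      using b0 by (intro order.trans[OF norm_triangle_ineq]) (simp add: norm_divide norm_mult del: of_real_diff of_real_divide)
    also have "\<dots> \<le> C * real n powr (\<theta> - 1) +
                 C * real n powr (\<theta> - 1) * ((5/2) ^ (2 * p) * (exp \<theta> * real n powr \<theta>))"
      using err[OF v] ratio norm_main_pgf_le[OF v \<delta>4 \<delta> n0] C
      by (intro add_mono mult_mono) (auto simp: lead_term_eq_main_pgf B_def)
    also have "\<dots> = C * real n powr (\<theta> - 1) + C * ((5/2) ^ (2 * p) * exp \<theta>) * real n powr (\<epsilon> - 1)"
      unfolding \<theta>(2) by (simp add: powr_add [symmetric] algebra_simps)
    also have "C * real n powr (\<theta> - 1) \<le> C * real n powr (\<epsilon> - 1)"
      using C \<theta> n0 by (intro mult_left_mono powr_mono) auto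
    also have "C * real n powr (\<epsilon> - 1) + C * ((5/2) ^ (2 * p) * exp \<theta>) * real n powr (\<epsilon> - 1) \<le> L * real n powr (\<epsilon> - 1)"
      by (simp add: L_def algebra_simps)
    finally show ?thesis by simp
  qed
  show ?thesis using \<delta>' \<delta>4 L main by blast
qed

section \<open>Mean and variance\<close>

lemma pgf_derivs_at_1:
  fixes X :: "'a \<Rightarrow> nat"
  assumes "finite (set_pmf M)"
  defines "f \<equiv> (\<lambda>v::complex. measure_pmf.expectation M (\<lambda>\<omega>. v ^ X \<omega>))"
  shows "f holomorphic_on A"
    and "(deriv ^^ 1) f 1 = of_real (measure_pmf.expectation M (\<lambda>\<omega>. real (X \<omega>)))"
    and "(deriv ^^ 2) f 1 = of_real (measure_pmf.expectation M (\<lambda>\<omega>. real (X \<omega>) * (real (X \<omega>) - 1)))"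
proof -
  let ?S = "set_pmf M"
  have f: "f = (\<lambda>v. \<Sum>\<omega>\<in>?S. of_real (pmf M \<omega>) * v ^ X \<omega>)"
    unfolding f_def using assms(1) by (intro ext, subst integral_measure_pmf[of ?S]) (auto simp: scaleR_conv_of_real)
  show "f holomorphic_on A" unfolding f by (intro holomorphic_intros)
  have d1: "deriv f = (\<lambda>v. \<Sum>\<omega>\<in>?S. of_real (pmf M \<omega>) * (of_nat (X \<omega>) * v ^ (X \<omega> - 1)))"
    unfolding f by (intro ext DERIV_imp_deriv) (auto intro!: derivative_eq_intros sum.cong simp: mult_ac)
  have d2: "deriv (deriv f) 1 = (\<Sum>\<omega>\<in>?S. of_real (pmf M \<omega>) * (of_nat (X \<omega>) * of_nat (X \<omega> - 1)))"
    unfolding d1 by (intro DERIV_imp_deriv) (auto intro!: derivative_eq_intros sum.cong simp: mult_ac)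
  show "(deriv ^^ 1) f 1 = of_real (measure_pmf.expectation M (\<lambda>\<omega>. real (X \<omega>)))"
    using assms(1) by (simp add: d1 integral_measure_pmf[of ?S])
  have "(of_nat (X \<omega>) * of_nat (X \<omega> - 1) :: complex) = of_real (real (X \<omega>) * (real (X \<omega>) - 1))" for \<omega>
    by (cases "X \<omega>") auto
  thus "(deriv ^^ 2) f 1 = of_real (measure_pmf.expectation M (\<lambda>\<omega>. real (X \<omega>) * (real (X \<omega>) - 1)))"
    using assms(1) by (simp add: numeral_2_eq_2 d2 integral_measure_pmf[of ?S] del: of_real_mult of_real_diff) simp
qed

definition main_logderiv :: "nat \<Rightarrow> nat \<Rightarrow> complex \<Rightarrow> complex" where
  "main_logderiv p n v = of_nat (2 * p - 1) * (1 / v - 2 / (2 * v - 1)) +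
     (\<Sum>k=1..n. of_real (2 * real p / real (p + k)) / (1 + of_real (2 * real p / real (p + k)) * (v - 1)))"

text \<open>
  The second summand has modulus less than 1/2, as \<open>2p/(p+k) \<le> 2\<close>.
\<close>

lemma main_factor_nonzero:
  fixes v :: complex
  assumes "norm (v - 1) < 1/4"
  shows "1 + of_real (2 * real p / real (p + k)) * (v - 1) \<noteq> 0"
proof
  assume "1 + of_real (2 * real p / real (p + k)) * (v - 1) = 0"
  hence "of_real (2 * real p / real (p + k)) * (v - 1) = -1" by (simp add: add_eq_0_iff)
  hence "norm (of_real (2 * real p / real (p + k)) * (v - 1)) = norm (-1 :: complex)" by (simp only:)
  hence "2 * real p / real (p + k) * norm (v - 1) = 1" 
    by (simp only: norm_mult norm_of_real norm_minus_cancel norm_one abs_of_nonneg[of "2 * real p / real (p + k)"]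
          divide_nonneg_nonneg of_nat_0_le_iff mult_nonneg_nonneg zero_le_numeral)
  moreover have "2 * real p / real (p + k) * norm (v - 1) \<le> 2 * (1/4)"
  proof (rule mult_mono)
    show "2 * real p / real (p + k) \<le> 2" by (cases "p + k = 0") (auto simp: divide_simps)
  qed (use assms in auto)
  ultimately show False by linarith
qed

lemma DERIV_prod_linear_factors:
  fixes a :: "nat \<Rightarrow> complex"
  assumes "\<And>k. 1 + a k * (v - 1) \<noteq> 0"
  shows "((\<lambda>v. \<Prod>k=1..m. 1 + a k * (v - 1)) has_field_derivative
          (\<Prod>k=1..m. 1 + a k * (v - 1)) * (\<Sum>k=1..m. a k / (1 + a k * (v - 1)))) (at v)"
proof (induction m)
  case (Suc m)
  have alg: "P * S * F + c * P = P * F * (S + c / F)" if "F \<noteq> 0" for P S F c :: complex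
    using that by (simp add: field_simps)
  have "((\<lambda>v. 1 + a (Suc m) * (v - 1)) has_field_derivative a (Suc m)) (at v)"
    by (auto intro!: derivative_eq_intros)
  from DERIV_mult[OF Suc this, unfolded alg[OF assms]] show ?case by simp
qed auto

lemma main_pgf_deriv:
  assumes "norm (v - 1) < 1/4"
  shows "(main_pgf p n has_field_derivative main_pgf p n v * main_logderiv p n v) (at v)"
proof -
  have v: "v \<noteq> 0" "2 * v - 1 \<noteq> 0"
    using near_1_bounds(3)[of v] assms by auto
  define e where "e = 1 / v - 2 / (2 * v - 1)"
  have "((\<lambda>v. v / (2 * v - 1)) has_field_derivative (1 * (2 * v - 1) - v * 2) / ((2 * v - 1) * (2 * v - 1))) (at v)"
    using v by (auto intro!: derivative_eq_intros)
  moreover have "(1 * (2 * v - 1) - v * 2) / ((2 * v - 1) * (2 * v - 1)) = v / (2 * v - 1) * e"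
    using v by (simp add: e_def divide_simps)
  ultimately have base: "((\<lambda>v. v / (2 * v - 1)) has_field_derivative v / (2 * v - 1) * e) (at v)" by simp
  have lead: "((\<lambda>v. (v / (2 * v - 1)) ^ m) has_field_derivative (v / (2 * v - 1)) ^ m * (of_nat m * e)) (at v)" for m
  proof (induction m)
    case (Suc m)
    have alg: "q * e * q ^ m + q ^ m * (of_nat m * e) * q = q ^ Suc m * (of_nat (Suc m) * e)" for q :: complex
      by (simp add: algebra_simps)
    from DERIV_mult[OF base Suc, unfolded alg] show ?case by simp
  qed auto
  note main_factor_nonzero[OF assms, of p]
  from DERIV_mult[OF lead[of "2 * p - 1"] DERIV_prod_linear_factors[OF this, where m = n]]
  show ?thesis
    unfolding main_pgf_def lead_const_def main_logderiv_def e_def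
    by (rule DERIV_cong) (simp only: ring_distribs mult_ac)
qed

lemma main_pgf_holomorphic: "main_pgf p n holomorphic_on ball 1 (1/4)"
proof (rule holomorphic_onI)
  fix v :: complex assume "v \<in> ball 1 (1/4)"
  hence "norm (v - 1) < 1/4" by (simp add: dist_norm norm_minus_commute)
  from main_pgf_deriv[OF this] show "main_pgf p n field_differentiable at v within ball 1 (1/4)"
    using field_differentiable_at_within field_differentiable_def by blast
qed

lemma main_pgf_derivs_at_1:
  fixes p n :: nat
  assumes "p \<ge> 1"
  defines "m1 \<equiv> 1 - 2 * real p + (\<Sum>k=1..n. 2 * real p / real (p + k))"
  shows "(deriv ^^ 1) (main_pgf p n) 1 = of_real m1"
    and "(deriv ^^ 2) (main_pgf p n) 1 = of_real (m1\<^sup>2 + (3 * (2 * real p - 1) - (\<Sum>k=1..n. (2 * real p / real (p + k))\<^sup>2)))"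
proof -
  let ?a = "\<lambda>k. complex_of_real (2 * real p / real (p + k))"
  have d: "deriv (main_pgf p n) v = main_pgf p n v * main_logderiv p n v" if "norm (v - 1) < 1/4" for v
    by (rule DERIV_imp_deriv main_pgf_deriv that)+
  have m1: "main_logderiv p n 1 = of_real m1"
    using assms(1) by (simp add: main_logderiv_def m1_def of_nat_diff)
  show "(deriv ^^ 1) (main_pgf p n) 1 = of_real m1"
    using d[of 1] m1 by simp
  have "((\<lambda>v. \<Sum>k=1..n. ?a k / (1 + ?a k * (v - 1))) has_field_derivative (\<Sum>k=1..n. - (?a k)\<^sup>2)) (at 1)"
    by (rule DERIV_sum) (auto intro!: derivative_eq_intros simp: power2_eq_square simp del: of_real_divide of_real_mult)
  moreover have "((\<lambda>v::complex. of_nat (2 * p - 1) * (1 / v - 2 / (2 * v - 1))) has_field_derivative of_nat (2 * p - 1) * 3) (at 1)"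
    by (rule derivative_eq_intros refl | simp)+
  ultimately have "(main_logderiv p n has_field_derivative of_nat (2 * p - 1) * 3 + (\<Sum>k=1..n. - (?a k)\<^sup>2)) (at 1)"
    unfolding main_logderiv_def by (intro DERIV_add)
  from DERIV_mult[OF main_pgf_deriv[of 1 p n] this]
  have "((\<lambda>v. main_pgf p n v * main_logderiv p n v) has_field_derivative
     (of_real m1)\<^sup>2 + (of_nat (2 * p - 1) * 3 + (\<Sum>k=1..n. - (?a k)\<^sup>2))) (at 1)"
    by (simp add: m1 power2_eq_square)
  hence "deriv (\<lambda>v. main_pgf p n v * main_logderiv p n v) 1 =
     (of_real m1)\<^sup>2 + (of_nat (2 * p - 1) * 3 + (\<Sum>k=1..n. - (?a k)\<^sup>2))"
    by (rule DERIV_imp_deriv)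
  moreover have "deriv (deriv (main_pgf p n)) 1 = deriv (\<lambda>v. main_pgf p n v * main_logderiv p n v) 1"
  proof (rule deriv_cong_ev)
    have "eventually (\<lambda>v::complex. v \<in> ball 1 (1/4)) (nhds 1)" by (rule eventually_nhds_in_open) auto
    thus "eventually (\<lambda>v. deriv (main_pgf p n) v = main_pgf p n v * main_logderiv p n v) (nhds 1)"
      by eventually_elim (auto intro!: d simp: dist_norm norm_minus_commute)
  qed auto
  ultimately show "(deriv ^^ 2) (main_pgf p n) 1 = of_real (m1\<^sup>2 + (3 * (2 * real p - 1) - (\<Sum>k=1..n. (2 * real p / real (p + k))\<^sup>2)))"
    using assms(1) by (simp add: numeral_2_eq_2 sum_negf of_nat_diff)
qed

lemma finite_mqs_input: "p \<le> n \<Longrightarrow> finite (set_pmf (mqs_input n p))"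
proof -
  assume "p \<le> n"
  let ?S = "{I. I \<subseteq> {1..n} \<and> card I = p}"
  have fin: "finite ?S" by (rule finite_subset[of _ "Pow {1..n}"]) auto
  have "card ?S = n choose p" using n_subsets[of "{1..n}" p] by simp
  hence "?S \<noteq> {}" using \<open>p \<le> n\<close> by (metis binomial_eq_0_iff card.empty not_less)
  thus ?thesis using fin by (simp add: mqs_input_def)
qed

definition num_passes :: "nat list \<times> nat set \<Rightarrow> nat" where "num_passes = (\<lambda>(xs, I). mqs_passes xs I)"

lemma X_mqs_eq: "X_mqs = (\<lambda>\<omega>. real (num_passes \<omega>))"
  by (simp add: X_mqs_def num_passes_def fun_eq_iff split: prod.splits)

lemma passes_pgf_eq:
  "p \<le> n \<Longrightarrow> passes_pgf p n = (\<lambda>v. measure_pmf.expectation (mqs_input n p) (\<lambda>\<omega>. v ^ num_passes \<omega>))"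
  using pgf_mqs_input[of p n] by (simp add: passes_pgf_def num_passes_def fun_eq_iff case_prod_unfold)

lemma V_mqs_eq:
  assumes "p \<le> n"
  shows "V_mqs n p = measure_pmf.expectation (mqs_input n p) (\<lambda>\<omega>. real (num_passes \<omega>) * (real (num_passes \<omega>) - 1))
                       + E_mqs n p - (E_mqs n p)\<^sup>2"
proof -
  have int: "integrable (mqs_input n p) f" for f :: "_ \<Rightarrow> real"
    by (rule integrable_measure_pmf_finite[OF finite_mqs_input[OF assms]])
  have "V_mqs n p = measure_pmf.expectation (mqs_input n p) (\<lambda>\<omega>. (X_mqs \<omega>)\<^sup>2) - (E_mqs n p)\<^sup>2"
    unfolding V_mqs_def E_mqs_def by (rule measure_pmf.variance_eq) (rule int)+
  also have "measure_pmf.expectation (mqs_input n p) (\<lambda>\<omega>. (X_mqs \<omega>)\<^sup>2) =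
      measure_pmf.expectation (mqs_input n p) (\<lambda>\<omega>. real (num_passes \<omega>) * (real (num_passes \<omega>) - 1) + X_mqs \<omega>)"
    by (intro Bochner_Integration.integral_cong refl) (simp add: X_mqs_eq power2_eq_square algebra_simps)
  also have "\<dots> = measure_pmf.expectation (mqs_input n p) (\<lambda>\<omega>. real (num_passes \<omega>) * (real (num_passes \<omega>) - 1)) + E_mqs n p"
    unfolding E_mqs_def by (rule Bochner_Integration.integral_add) (rule int)+
  finally show ?thesis .
qed

text \<open>
  Cauchy's inequality on a fixed small circle around 1 turns the uniform bound for the remainder into
  bounds for its first two derivatives at 1.
\<close>

lemma factorial_moments_approx:
  assumes p: "p \<ge> 1" and \<epsilon>: "\<epsilon> > 0"
  shows "\<exists>K. \<forall>n\<ge>p.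
     \<bar>E_mqs n p - (1 - 2 * real p + (\<Sum>k=1..n. 2 * real p / real (p + k)))\<bar> \<le> K * real n powr (\<epsilon> - 1) \<and>
     \<bar>measure_pmf.expectation (mqs_input n p) (\<lambda>\<omega>. real (num_passes \<omega>) * (real (num_passes \<omega>) - 1)) -
       ((1 - 2 * real p + (\<Sum>k=1..n. 2 * real p / real (p + k)))\<^sup>2 +
        (3 * (2 * real p - 1) - (\<Sum>k=1..n. (2 * real p / real (p + k))\<^sup>2)))\<bar> \<le> K * real n powr (\<epsilon> - 1)"
proof -
  obtain \<delta> K where \<delta>: "\<delta> > 0" "\<delta> \<le> 1/4" and K: "K > 0" and
    bound: "\<And>n v. n \<ge> p \<Longrightarrow> norm (v - 1) \<le> \<delta> \<Longrightarrow> norm (passes_pgf p n v - main_pgf p n v) \<le> K * real n powr (\<epsilon> - 1)"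
    using passes_pgf_approx[OF p \<epsilon>] by blast
  define r where "r = \<delta> / 2"
  have r: "r > 0" "r < \<delta>" "r < 1/4" using \<delta> by (auto simp: r_def)
  define L where "L = max (fact 1 * (2 * K) / r ^ 1) (fact 2 * (2 * K) / r ^ 2)"
  show ?thesis
  proof (intro exI[of _ L] allI impI)
    fix n assume n: "n \<ge> p"
    hence n0: "real n > 0" using p by simp
    define f where "f = (\<lambda>v. passes_pgf p n v - main_pgf p n v)"
    note P = pgf_derivs_at_1[OF finite_mqs_input[OF n], of num_passes, folded passes_pgf_eq[OF n]]
    have hol: "passes_pgf p n holomorphic_on ball 1 (1/4)" "main_pgf p n holomorphic_on ball 1 (1/4)"
      by (rule P main_pgf_holomorphic)+
    hence f: "f holomorphic_on ball 1 (1/4)" unfolding f_def by (intro holomorphic_intros)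
    have bd: "norm ((deriv ^^ k) f 1) \<le> L * real n powr (\<epsilon> - 1)" if "k = 1 \<or> k = 2" for k
    proof -
      have "norm ((deriv ^^ k) f 1) \<le> fact k * (2 * K * real n powr (\<epsilon> - 1)) / r ^ k"
      proof (rule Cauchy_higher_deriv_bound)
        show "f holomorphic_on ball 1 r" using f by (rule holomorphic_on_subset) (use r in auto)
        show "continuous_on (cball 1 r) f"
          by (rule holomorphic_on_imp_continuous_on[OF holomorphic_on_subset[OF f]]) (use r in auto)
        fix w :: complex assume "w \<in> ball 1 r"
        hence "norm (w - 1) \<le> \<delta>" using r by (simp add: dist_norm norm_minus_commute)
        hence "norm (f w) \<le> K * real n powr (\<epsilon> - 1)" unfolding f_def by (rule bound[OF n])
        also have "\<dots> < 2 * K * real n powr (\<epsilon> - 1)" using K n0 by simp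
        finally show "f w \<in> ball 0 (2 * K * real n powr (\<epsilon> - 1))" by simp
      qed (use r that in auto)
      also have "\<dots> = (fact k * (2 * K) / r ^ k) * real n powr (\<epsilon> - 1)" by simp
      also have "\<dots> \<le> L * real n powr (\<epsilon> - 1)"
        using that by (intro mult_right_mono) (auto simp: L_def)
      finally show ?thesis .
    qed
    have split: "(deriv ^^ k) f 1 = (deriv ^^ k) (passes_pgf p n) 1 - (deriv ^^ k) (main_pgf p n) 1" for k
      unfolding f_def by (rule higher_deriv_diff[OF hol]) auto
    have norm_diff: "norm (of_real x - of_real y :: complex) = \<bar>x - y\<bar>" for x y
      by (simp only: of_real_diff [symmetric] norm_of_real)
    have E: "E_mqs n p = measure_pmf.expectation (mqs_input n p) (\<lambda>\<omega>. real (num_passes \<omega>))"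
      by (simp add: E_mqs_def X_mqs_eq)
    note main = main_pgf_derivs_at_1[OF p, of n]
    show "\<bar>E_mqs n p - (1 - 2 * real p + (\<Sum>k=1..n. 2 * real p / real (p + k)))\<bar> \<le> L * real n powr (\<epsilon> - 1) \<and>
     \<bar>measure_pmf.expectation (mqs_input n p) (\<lambda>\<omega>. real (num_passes \<omega>) * (real (num_passes \<omega>) - 1)) -
       ((1 - 2 * real p + (\<Sum>k=1..n. 2 * real p / real (p + k)))\<^sup>2 +
        (3 * (2 * real p - 1) - (\<Sum>k=1..n. (2 * real p / real (p + k))\<^sup>2)))\<bar> \<le> L * real n powr (\<epsilon> - 1)"
      using bd[of 1] bd[of 2] unfolding split P(2,3) main norm_diff E by simp
  qed
qed

lemma harm_shift: "(\<Sum>k=1..n. 1 / real (p + k)) = harm (n + p) - harm p"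
  by (induction n) (auto simp: harm_Suc inverse_eq_divide add_ac)

lemma harm2_shift: "(\<Sum>k=1..n. 1 / (real (p + k))\<^sup>2) = harm2 (n + p) - harm2 p"
  by (induction n) (auto simp: harm2_def add_ac)

lemma harm_asymp:
  assumes "n \<ge> 1"
  shows "\<bar>harm (n + p) - ln (real n) - euler_mascheroni\<bar> \<le> real (p + 2) / real n"
proof -
  define m where "m = n + p"
  have m: "m \<ge> 1" "m \<ge> n" using assms by (auto simp: m_def)
  have eb: "euler_mascheroni \<le> harm m - ln (real (Suc m)) + inverse (real (2 * m))"
    "harm m - ln (real (Suc m)) + inverse (real (2 * (m + 1))) \<le> euler_mascheroni"
    using euler_mascheroni_bounds[of m] m by auto
  have "ln (real (Suc m)) - ln (real n) = ln (1 + real (p + 1) / real n)"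
    using assms by (subst ln_divide_pos [symmetric]) (auto simp: m_def field_simps)
  also have "\<dots> \<le> real (p + 1) / real n" by (rule ln_add_one_self_le_self) simp
  finally have 1: "ln (real (Suc m)) - ln (real n) \<le> real (p + 1) / real n" .
  have 2: "ln (real (Suc m)) \<ge> ln (real n)" using m assms by simp
  have "inverse (real (2 * m)) \<le> inverse (real n)" using m assms by (intro le_imp_inverse_le) auto
  hence 3: "inverse (real (2 * m)) \<le> 1 / real n" by (simp add: inverse_eq_divide)
  have 4: "inverse (real (2 * (m + 1))) \<ge> 0" by simp
  have "real (p + 2) / real n = real (p + 1) / real n + 1 / real n"
    by (simp add: add_divide_distrib [symmetric])
  moreover have "real (p + 1) / real n \<ge> 0" by simp
  ultimately show ?thesis using eb 1 2 3 4 unfolding m_def [symmetric] by linarith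
qed

lemma harm2_tail:
  assumes "m \<ge> 1"
  shows "harm2 m \<le> pi\<^sup>2 / 6" "pi\<^sup>2 / 6 \<le> harm2 m + 1 / real m"
proof -
  have lim: "harm2 \<longlonglongrightarrow> pi\<^sup>2 / 6"
  proof -
    have *: "harm2 = (\<lambda>m. \<Sum>i<m. 1 / (real i + 1)\<^sup>2)"
      unfolding fun_eq_iff harm2_def by (intro allI sum.reindex_bij_witness[of _ Suc "\<lambda>k. k - 1"]) auto
    show ?thesis using inverse_squares_sums unfolding * sums_def by (simp add: add_ac)
  qed
  have "incseq harm2" by (rule incseq_SucI) (simp add: harm2_def)
  from incseq_le[OF this lim] show "harm2 m \<le> pi\<^sup>2 / 6" .
  have "decseq (\<lambda>k. harm2 (Suc k) + 1 / real (Suc k))"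
  proof (rule decseq_SucI)
    fix k
    have "1 / (real (Suc (Suc k)))\<^sup>2 \<le> 1 / (real (Suc k) * real (Suc (Suc k)))"
      unfolding power2_eq_square by (intro divide_left_mono mult_right_mono) auto
    also have "\<dots> = 1 / real (Suc k) - 1 / real (Suc (Suc k))" by (simp add: field_simps)
    finally show "harm2 (Suc (Suc k)) + 1 / real (Suc (Suc k)) \<le> harm2 (Suc k) + 1 / real (Suc k)"
      by (simp add: harm2_def)
  qed
  moreover have "(\<lambda>k. harm2 (Suc k) + 1 / real (Suc k)) \<longlonglongrightarrow> pi\<^sup>2 / 6 + 0"
    by (intro tendsto_add LIMSEQ_Suc lim LIMSEQ_Suc[OF lim_1_over_n])
  ultimately have "pi\<^sup>2 / 6 + 0 \<le> harm2 (Suc (m - 1)) + 1 / real (Suc (m - 1))" by (rule decseq_ge)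
  thus "pi\<^sup>2 / 6 \<le> harm2 m + 1 / real m" using assms by simp
qed

text \<open>
  With \<open>m\<close> the first derivative of the main term at 1 and \<open>r\<^sub>1\<close>, \<open>r\<^sub>2\<close> the errors of the factorial
  moments, the squares of \<open>m\<close> cancel in the variance. The worst remaining error is \<open>m r\<^sub>1\<close>, with
  \<open>m\<close> of logarithmic size; therefore the moments are used with \<open>\<epsilon>/2\<close>.
\<close>

lemma moment_asymptotics:
  assumes p: "p \<ge> 1" and \<epsilon>: "\<epsilon> > 0"
  shows "(\<lambda>n. E_mqs n p
            - (2 * real p * ln (real n) + 1 - 2 * real p - 2 * real p * harm p
               + 2 * real p * euler_mascheroni))
           \<in> O[sequentially](\<lambda>n. 1 / real n powr (1 - \<epsilon>))" (is ?E)
    and "(\<lambda>n. V_mqs n p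
            - (2 * real p * ln (real n) + 4 * real p - 2 - 2 * real p * harm p
               + 2 * real p * euler_mascheroni + 4 * (real p)\<^sup>2 * harm2 p
               - 2 / 3 * pi\<^sup>2 * (real p)\<^sup>2))
           \<in> O[sequentially](\<lambda>n. 1 / real n powr (1 - \<epsilon>))" (is ?V)
proof -
  define m1 where "m1 = (\<lambda>n. 1 - 2 * real p + (\<Sum>k=1..n. 2 * real p / real (p + k)))"
  define m2 where "m2 = (\<lambda>n. (m1 n)\<^sup>2 + (3 * (2 * real p - 1) - (\<Sum>k=1..n. (2 * real p / real (p + k))\<^sup>2)))"
  define F2 where "F2 = (\<lambda>n. measure_pmf.expectation (mqs_input n p) (\<lambda>\<omega>. real (num_passes \<omega>) * (real (num_passes \<omega>) - 1)))"
  define r1 where "r1 = (\<lambda>n. E_mqs n p - m1 n)"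
  define r2 where "r2 = (\<lambda>n. F2 n - m2 n)"
  define s1 where "s1 = (\<lambda>n. 2 * real p * (harm (n + p) - ln (real n) - euler_mascheroni))"
  define s2 where "s2 = (\<lambda>n. 4 * (real p)\<^sup>2 * (harm2 (n + p) - pi\<^sup>2 / 6))"
  have m1: "m1 n = 2 * real p * ln (real n) + 1 - 2 * real p - 2 * real p * harm p + 2 * real p * euler_mascheroni + s1 n" for n
  proof -
    have "(\<Sum>k=1..n. 2 * real p / real (p + k)) = 2 * real p * (harm (n + p) - harm p)"
      unfolding harm_shift [symmetric] by (simp add: sum_distrib_left)
    thus ?thesis by (simp add: m1_def s1_def algebra_simps)
  qed
  have sq: "(\<Sum>k=1..n. (2 * real p / real (p + k))\<^sup>2) = 2/3 * pi\<^sup>2 * (real p)\<^sup>2 - 4 * (real p)\<^sup>2 * harm2 p + s2 n" for n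
  proof -
    have "(\<Sum>k=1..n. (2 * real p / real (p + k))\<^sup>2) = 4 * (real p)\<^sup>2 * (harm2 (n + p) - harm2 p)"
      unfolding harm2_shift [symmetric] by (simp add: sum_distrib_left power_divide power_mult_distrib)
    thus ?thesis by (simp add: s2_def algebra_simps)
  qed
  have *: "(\<lambda>n. 1 / real n powr (1 - \<epsilon>)) = (\<lambda>n. real n powr (\<epsilon> - 1))"
    by (simp add: powr_minus_divide [symmetric])
  have r: "r1 \<in> O(\<lambda>n. real n powr (\<epsilon> / 2 - 1))" "r2 \<in> O(\<lambda>n. real n powr (\<epsilon> / 2 - 1))"
  proof -
    obtain K where K: "\<And>n. n \<ge> p \<Longrightarrow> \<bar>r1 n\<bar> \<le> K * real n powr (\<epsilon> / 2 - 1) \<and> \<bar>r2 n\<bar> \<le> K * real n powr (\<epsilon> / 2 - 1)"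
      using factorial_moments_approx[OF p, of "\<epsilon> / 2"] \<epsilon> unfolding r1_def r2_def F2_def m2_def m1_def by auto
    show "r1 \<in> O(\<lambda>n. real n powr (\<epsilon> / 2 - 1))" "r2 \<in> O(\<lambda>n. real n powr (\<epsilon> / 2 - 1))"
      by (rule bigoI[of _ K], rule eventually_sequentiallyI[of p], use K in simp)+
  qed
  have s: "s1 \<in> O(\<lambda>n. 1 / real n)" "s2 \<in> O(\<lambda>n. 1 / real n)"
  proof -
    show "s1 \<in> O(\<lambda>n. 1 / real n)"
    proof (rule bigoI[of _ "2 * real p * real (p + 2)"], rule eventually_sequentiallyI[of 1])
      fix n :: nat assume n: "n \<ge> 1"
      have "norm (s1 n) = 2 * real p * \<bar>harm (n + p) - ln (real n) - euler_mascheroni\<bar>"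
        by (simp add: s1_def abs_mult)
      also have "\<dots> \<le> 2 * real p * (real (p + 2) / real n)"
        using harm_asymp[OF n, of p] by (intro mult_left_mono) auto
      finally show "norm (s1 n) \<le> 2 * real p * real (p + 2) * norm (1 / real n)" by simp
    qed
    show "s2 \<in> O(\<lambda>n. 1 / real n)"
    proof (rule bigoI[of _ "4 * (real p)\<^sup>2"], rule eventually_sequentiallyI[of 1])
      fix n :: nat assume n: "n \<ge> 1"
      have "1 / real (n + p) \<le> 1 / real n" using n by (intro divide_left_mono) auto
      hence "\<bar>harm2 (n + p) - pi\<^sup>2 / 6\<bar> \<le> 1 / real n"
        using harm2_tail[of "n + p"] n by linarith
      hence "4 * (real p)\<^sup>2 * \<bar>harm2 (n + p) - pi\<^sup>2 / 6\<bar> \<le> 4 * (real p)\<^sup>2 * (1 / real n)"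
        by (intro mult_left_mono) auto
      thus "norm (s2 n) \<le> 4 * (real p)\<^sup>2 * norm (1 / real n)"
        by (simp add: s2_def abs_mult)
    qed
  qed
  have inv: "(\<lambda>n. 1 / real n) \<in> O(\<lambda>n. real n powr (\<epsilon> - 1))"
    using \<epsilon> by real_asymp
  have half: "(\<lambda>n. real n powr (\<epsilon> / 2 - 1)) \<in> O(\<lambda>n. real n powr (\<epsilon> - 1))"
    using \<epsilon> by real_asymp
  have small: "s1 \<in> O(\<lambda>n. real n powr (\<epsilon> - 1))" "s2 \<in> O(\<lambda>n. real n powr (\<epsilon> - 1))"
     "r1 \<in> O(\<lambda>n. real n powr (\<epsilon> - 1))" "r2 \<in> O(\<lambda>n. real n powr (\<epsilon> - 1))"
    using s r landau_o.big_trans[OF _ inv] landau_o.big_trans[OF _ half] by auto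
  have "(\<lambda>n. r1 n + s1 n) \<in> O(\<lambda>n. real n powr (\<epsilon> - 1))"
    by (intro sum_in_bigo small)
  moreover have "(\<lambda>n. r1 n + s1 n) = (\<lambda>n. E_mqs n p
            - (2 * real p * ln (real n) + 1 - 2 * real p - 2 * real p * harm p + 2 * real p * euler_mascheroni))"
    by (simp add: r1_def m1 algebra_simps)
  ultimately show ?E unfolding * by simp
  have m1_bigo: "(\<lambda>n. 2 * m1 n + r1 n) \<in> O(\<lambda>n. real n powr (\<epsilon> / 2))"
  proof -
    have 1: "(\<lambda>n. 2 * (2 * real p * ln (real n)) + 2 * (1 - 2 * real p - 2 * real p * harm p + 2 * real p * euler_mascheroni)) \<in> O(\<lambda>n. real n powr (\<epsilon> / 2))"
    proof -
      have scale: "(\<lambda>n. a * f n) \<in> O(g)" if "f \<in> O(g)" for a :: real and f g :: "nat \<Rightarrow> real"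
        using that by (cases "a = 0") auto
      have "(\<lambda>n. ln (real n)) \<in> O(\<lambda>n. real n powr (\<epsilon> / 2))" using \<epsilon> by real_asymp
      from scale[OF this, of "2 * (2 * real p)"] have
        "(\<lambda>n. 2 * (2 * real p * ln (real n))) \<in> O(\<lambda>n. real n powr (\<epsilon> / 2))" by (simp only: mult.assoc)
      moreover have "(\<lambda>n::nat. 1 :: real) \<in> O(\<lambda>n. real n powr (\<epsilon> / 2))" using \<epsilon> by real_asymp
      from scale[OF this, of "2 * (1 - 2 * real p - 2 * real p * harm p + 2 * real p * euler_mascheroni)"] have
        "(\<lambda>n. 2 * (1 - 2 * real p - 2 * real p * harm p + 2 * real p * euler_mascheroni)) \<in> O(\<lambda>n. real n powr (\<epsilon> / 2))"
        by (simp only: mult_1_right)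
      ultimately show ?thesis by (rule sum_in_bigo)
    qed
    have i2: "(\<lambda>n. 1 / real n) \<in> O(\<lambda>n. real n powr (\<epsilon> / 2))" 
      "(\<lambda>n. real n powr (\<epsilon> / 2 - 1)) \<in> O(\<lambda>n. real n powr (\<epsilon> / 2))" using \<epsilon> by real_asymp+
    have "(\<lambda>n. (2 * (2 * real p * ln (real n)) + 2 * (1 - 2 * real p - 2 * real p * harm p + 2 * real p * euler_mascheroni)) + (2 * s1 n + r1 n))
        \<in> O(\<lambda>n. real n powr (\<epsilon> / 2))"
      using landau_o.big_trans[OF s(1) i2(1)] landau_o.big_trans[OF r(1) i2(2)]
      by (intro sum_in_bigo(1)[OF 1] sum_in_bigo) auto
    thus ?thesis by (simp add: m1 algebra_simps)
  qed
  have "(\<lambda>n. (2 * m1 n + r1 n) * r1 n) \<in> O(\<lambda>n. real n powr (\<epsilon> / 2) * real n powr (\<epsilon> / 2 - 1))"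
    by (rule landau_o.big.mult[OF m1_bigo r(1)])
  also have "(\<lambda>n. real n powr (\<epsilon> / 2) * real n powr (\<epsilon> / 2 - 1)) = (\<lambda>n. real n powr (\<epsilon> - 1))"
    by (simp add: powr_add [symmetric])
  finally have "(\<lambda>n. s1 n - s2 n + r2 n + r1 n - (2 * m1 n + r1 n) * r1 n) \<in> O(\<lambda>n. real n powr (\<epsilon> - 1))"
    by (intro sum_in_bigo small)
  moreover have "eventually (\<lambda>n. s1 n - s2 n + r2 n + r1 n - (2 * m1 n + r1 n) * r1 n = V_mqs n p
            - (2 * real p * ln (real n) + 4 * real p - 2 - 2 * real p * harm p
               + 2 * real p * euler_mascheroni + 4 * (real p)\<^sup>2 * harm2 p
               - 2 / 3 * pi\<^sup>2 * (real p)\<^sup>2)) sequentially"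
  proof (rule eventually_sequentiallyI[of p])
    fix n assume n: "n \<ge> p"
    have "V_mqs n p = (m2 n + r2 n) + (m1 n + r1 n) - (m1 n + r1 n)\<^sup>2"
      unfolding V_mqs_eq[OF n] r1_def r2_def F2_def by simp
    also have "\<dots> = m2 n - (m1 n)\<^sup>2 + m1 n + r2 n + r1 n - (2 * m1 n + r1 n) * r1 n"
      by (simp add: power2_eq_square algebra_simps)
    also have "m2 n - (m1 n)\<^sup>2 = 3 * (2 * real p - 1) - (2/3 * pi\<^sup>2 * (real p)\<^sup>2 - 4 * (real p)\<^sup>2 * harm2 p + s2 n)"
      unfolding m2_def sq by simp
    also have "\<dots> + m1 n = (2 * real p * ln (real n) + 4 * real p - 2 - 2 * real p * harm p
               + 2 * real p * euler_mascheroni + 4 * (real p)\<^sup>2 * harm2 p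
               - 2 / 3 * pi\<^sup>2 * (real p)\<^sup>2) + s1 n - s2 n"
      unfolding m1 by (simp add: algebra_simps)
    finally show "s1 n - s2 n + r2 n + r1 n - (2 * m1 n + r1 n) * r1 n = V_mqs n p
            - (2 * real p * ln (real n) + 4 * real p - 2 - 2 * real p * harm p
               + 2 * real p * euler_mascheroni + 4 * (real p)\<^sup>2 * harm2 p
               - 2 / 3 * pi\<^sup>2 * (real p)\<^sup>2)" by simp
  qed
  ultimately show ?V unfolding * by (simp cong: landau_o.big.in_cong)
qed

section \<open>The generating function on the unit circle near 1\<close>

lemma norm_exp_minus_1_le: "norm (exp z - 1 :: complex) \<le> norm z * exp (norm z)"
proof -
  have "norm (exp z - exp 0) \<le> exp (norm z) * norm (z - 0)"
  proof (rule field_differentiable_bound[of "cball 0 (norm z)"])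
    fix u :: complex assume "u \<in> cball 0 (norm z)"
    thus "norm (exp u) \<le> exp (norm z)"
      using norm_exp[of u] by (auto intro: order.trans)
  qed (auto intro: DERIV_subset[OF DERIV_exp])
  thus ?thesis by (simp add: mult.commute)
qed

lemma Ln_one_plus_approx:
  assumes "norm z \<le> 1/2"
  shows "norm (Ln (1 + z) - z) \<le> 2 * (norm z)\<^sup>2" "norm (Ln (1 + z)) \<le> 2 * norm z"
proof -
  have "norm (Ln (1 + z) - z) \<le> (norm z)\<^sup>2 / (1 - norm z)"
    using assms by (intro Ln_approx_linear) auto
  also have "\<dots> \<le> (norm z)\<^sup>2 / (1/2)" using assms by (intro divide_left_mono) auto
  finally show 1: "norm (Ln (1 + z) - z) \<le> 2 * (norm z)\<^sup>2" by simp
  have "2 * (norm z)\<^sup>2 \<le> 2 * (1/2) * norm z"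
    unfolding power2_eq_square using assms mult_right_mono[of "norm z" "1/2" "norm z"] by simp
  thus "norm (Ln (1 + z)) \<le> 2 * norm z"
    using 1 norm_triangle_ineq[of "Ln (1 + z) - z" z] by simp
qed

text \<open>
  The logarithm of the main term is \<open>(v - 1) \<Sum> 2p/(p+k) + O(|v - 1|)\<close>: the quadratic terms of the
  logarithms add up to a convergent series, and the sum is \<open>2 p log n + O(1)\<close>.
\<close>

lemma main_pgf_eq_exp:
  assumes p: "p \<ge> 1"
  shows "\<exists>C\<ge>0. \<forall>n\<ge>1. \<forall>v. norm (v - 1) \<le> 1/4 \<longrightarrow>
    (\<exists>E. norm E \<le> C * norm (v - 1) \<and> main_pgf p n v = exp ((v - 1) * of_real (2 * real p * ln (real n)) + E))"
proof -
  define C0 where "C0 = 2 * real p * \<bar>harm p - euler_mascheroni\<bar> + 2 * real p * real (p + 2)"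
  define C2 where "C2 = 4 * (real p)\<^sup>2 * (pi\<^sup>2 / 6)"
  define C where "C = 8 * real (2 * p - 1) + 2 * C2 + C0"
  have C0: "C0 \<ge> 0" by (simp add: C0_def)
  have C2: "C2 \<ge> 0" by (simp add: C2_def)
  show ?thesis
  proof (intro exI[of _ C] conjI allI impI)
    fix n :: nat and v :: complex assume n: "n \<ge> 1" and v: "norm (v - 1) \<le> 1/4"
    define u where "u = v - 1"
    have u: "norm u \<le> 1/4" using v by (simp add: u_def)
    define a where "a = (\<lambda>k. 2 * real p / real (p + k))"
    define L where "L = Ln (1 + u) - Ln (1 + 2 * u)"
    define Q where "Q = (\<Sum>k=1..n. Ln (1 + of_real (a k) * u) - of_real (a k) * u)"
    define S where "S = (\<Sum>k=1..n. a k)"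
    define s where "s = 2 * real p * ln (real n)"
    have a: "0 \<le> a k" "a k \<le> 2" for k
      by (cases "p + k = 0"; simp add: a_def divide_simps)+
    have au: "norm (of_real (a k) * u) = a k * norm u" "a k * norm u \<le> 1/2" for k
      using a[of k] u mult_mono[of "a k" 2 "norm u" "1/4"] by (auto simp: norm_mult)
    have nz: "1 + z \<noteq> 0" if "norm z \<le> 1/2" for z :: complex
    proof
      assume "1 + z = 0"
      hence "z = -1" by (simp add: add_eq_0_iff)
      thus False using that by simp
    qed
    have u2: "norm (2 * u) \<le> 1/2" using u by (simp add: norm_mult)
    have S: "\<bar>S - s\<bar> \<le> C0"
    proof -
      have "S = 2 * real p * (harm (n + p) - harm p)"
        unfolding S_def a_def harm_shift [symmetric] by (simp add: sum_distrib_left)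
      hence "S - s = 2 * real p * (harm (n + p) - ln (real n) - euler_mascheroni) - 2 * real p * (harm p - euler_mascheroni)"
        by (simp add: s_def algebra_simps)
      also have "\<bar>\<dots>\<bar> \<le> 2 * real p * \<bar>harm (n + p) - ln (real n) - euler_mascheroni\<bar> + 2 * real p * \<bar>harm p - euler_mascheroni\<bar>"
        by (rule order.trans[OF abs_triangle_ineq4]) (simp add: abs_mult)
      also have "\<dots> \<le> 2 * real p * real (p + 2) + 2 * real p * \<bar>harm p - euler_mascheroni\<bar>"
      proof (intro add_right_mono mult_left_mono)
        have "real (p + 2) / real n \<le> real (p + 2)"
          using n by (simp add: divide_le_eq mult_le_cancel_left1)
        thus "\<bar>harm (n + p) - ln (real n) - euler_mascheroni\<bar> \<le> real (p + 2)"
          using harm_asymp[OF n, of p] by linarith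
      qed auto
      finally show ?thesis by (simp add: C0_def add.commute)
    qed
    have Q: "norm Q \<le> 2 * C2 * norm u"
    proof -
      have "norm Q \<le> (\<Sum>k=1..n. 2 * (a k * norm u)\<^sup>2)"
        unfolding Q_def
        by (intro sum_norm_le order.trans[OF Ln_one_plus_approx(1)]) (use au in auto)
      also have "\<dots> = 2 * (norm u)\<^sup>2 * (4 * (real p)\<^sup>2 * (\<Sum>k=1..n. 1 / (real (p + k))\<^sup>2))"
        by (simp add: sum_distrib_left power_mult_distrib a_def power_divide mult_ac)
      also have "\<dots> \<le> 2 * (norm u * 1) * C2"
      proof -
        have "(norm u)\<^sup>2 \<le> norm u * 1"
          unfolding power2_eq_square using u by (intro mult_left_mono) auto
        moreover have "(\<Sum>k=1..n. 1 / (real (p + k))\<^sup>2) \<le> pi\<^sup>2 / 6"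
        proof -
          have "0 \<le> harm2 p" by (simp add: harm2_def sum_nonneg)
          thus ?thesis unfolding harm2_shift using harm2_tail(1)[of "n + p"] n by simp
        qed
        ultimately show ?thesis unfolding C2_def
          by (intro mult_mono mult_left_mono) (auto intro!: sum_nonneg mult_nonneg_nonneg)
      qed
      finally show ?thesis by (simp add: mult_ac)
    qed
    have L: "norm L \<le> 8 * norm u"
    proof -
      have "norm L \<le> norm (Ln (1 + u)) + norm (Ln (1 + 2 * u))"
        unfolding L_def by (rule norm_triangle_ineq4)
      also have "\<dots> \<le> 2 * norm u + 2 * norm (2 * u)"
        using u u2 by (intro add_mono Ln_one_plus_approx(2)) auto
      finally have "norm L \<le> 6 * norm u" by (simp add: norm_mult)
      thus ?thesis using norm_ge_zero[of u] by linarith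
    qed
    define E where "E = of_nat (2 * p - 1) * L + Q + of_real (S - s) * u"
    have "norm E \<le> norm (of_nat (2 * p - 1) * L) + norm Q + norm (of_real (S - s) * u)"
      unfolding E_def by (intro order.trans[OF norm_triangle_ineq] add_mono order.refl norm_triangle_ineq)
    also have "\<dots> \<le> real (2 * p - 1) * (8 * norm u) + 2 * C2 * norm u + C0 * norm u"
      unfolding norm_mult norm_of_nat norm_of_real using L Q S
      by (intro add_mono mult_left_mono mult_right_mono) auto
    also have "\<dots> = C * norm (v - 1)" by (simp add: C_def u_def algebra_simps)
    finally have E: "norm E \<le> C * norm (v - 1)" .
    have "exp (u * of_real s + E) = exp (of_nat (2 * p - 1) * L + (\<Sum>k=1..n. Ln (1 + of_real (a k) * u)))"
    proof -
      have uS: "of_real S * u = (\<Sum>k=1..n. of_real (a k) * u)"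
        by (simp add: S_def sum_distrib_right)
      have "u * of_real s + E = of_nat (2 * p - 1) * L + (Q + of_real S * u)"
        by (simp add: E_def algebra_simps)
      also have "Q + of_real S * u = (\<Sum>k=1..n. Ln (1 + of_real (a k) * u))"
        unfolding Q_def uS by (simp add: sum_subtractf)
      finally show ?thesis by simp
    qed
    also have "\<dots> = exp L ^ (2 * p - 1) * (\<Prod>k=1..n. exp (Ln (1 + of_real (a k) * u)))"
      by (simp add: exp_add exp_of_nat_mult exp_sum del: of_nat_diff)
    also have "(\<Prod>k=1..n. exp (Ln (1 + of_real (a k) * u))) = (\<Prod>k=1..n. 1 + of_real (a k) * u)"
      using au nz by (intro prod.cong refl exp_Ln) auto
    also have "exp L = v / (2 * v - 1)"
      unfolding L_def using nz[of u] nz[OF u2] u by (simp add: exp_diff u_def algebra_simps)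
    finally have "main_pgf p n v = exp ((v - 1) * of_real s + E)"
      by (simp add: main_pgf_def lead_const_def a_def u_def)
    thus "\<exists>E. norm E \<le> C * norm (v - 1) \<and> main_pgf p n v = exp ((v - 1) * of_real (2 * real p * ln (real n)) + E)"
      using E by (auto simp: s_def)
  qed (use C0 C2 in \<open>simp add: C_def\<close>)
qed

text \<open>
  Trades the exponential for a rational bound whose integral is an arctangent.
\<close>

lemma exp_decay_bound:
  assumes "(x::real) \<ge> 0" shows "(1 + x) * exp (- x / 4) \<le> 32 / (1 + x)"
proof -
  have "(1 + x)\<^sup>2 \<le> 32 * (1 + x / 4 + (x / 4)\<^sup>2 / 2)"
    using assms by (simp add: power2_eq_square algebra_simps)
  also have "\<dots> \<le> 32 * exp (x / 4)"
    using assms by (intro mult_left_mono exp_lower_Taylor_quadratic) auto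
  finally have "(1 + x)\<^sup>2 * exp (- x / 4) \<le> 32 * (exp (x / 4) * exp (- x / 4))"
    by (simp add: mult_right_mono flip: mult.assoc)
  also have "exp (x / 4) * exp (- x / 4) = 1" by (simp flip: exp_add)
  finally show ?thesis using assms by (simp add: field_simps power2_eq_square)
qed

text \<open>
  On the unit circle \<open>v - 1 = i \<theta> - \<theta>\<^sup>2/2 + O(\<theta>\<^sup>3)\<close>; centring removes the linear term and the quadratic
  one is the Gaussian. The cubic error times \<open>log n\<close> is absorbed by half of the Gaussian exponent because
  \<open>\<theta>\<close> is small.
\<close>

lemma main_pgf_iexp:
  assumes p: "p \<ge> 1"
  shows "\<exists>K\<ge>0. \<forall>n\<ge>1. \<forall>\<theta>. 0 \<le> \<theta> \<longrightarrow> \<theta> \<le> 1/4 \<longrightarrow>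
     norm (main_pgf p n (iexp \<theta>) * iexp (- \<theta> * (2 * real p * ln (real n))) - exp (- (2 * real p * ln (real n)) * \<theta>\<^sup>2 / 2))
       \<le> \<theta> * (K / (1 + 2 * real p * ln (real n) * \<theta>\<^sup>2))"
proof -
  obtain C where C: "C \<ge> 0" and
    main: "\<And>n v. n \<ge> 1 \<Longrightarrow> norm (v - 1) \<le> 1/4 \<Longrightarrow>
      \<exists>E. norm E \<le> C * norm (v - 1) \<and> main_pgf p n v = exp ((v - 1) * of_real (2 * real p * ln (real n)) + E)"
    using main_pgf_eq_exp[OF p] by blast
  define K where "K = exp C * (C + 1) * 32"
  show ?thesis
  proof (intro exI[of _ K] conjI allI impI)
    fix n :: nat and \<theta> :: real assume n: "n \<ge> 1" and \<theta>: "0 \<le> \<theta>" "\<theta> \<le> 1/4"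
    define s where "s = 2 * real p * ln (real n)"
    define x where "x = s * \<theta>\<^sup>2"
    have s: "s \<ge> 0" using n by (simp add: s_def)
    have x: "x \<ge> 0" using s by (simp add: x_def)
    define v where "v = iexp \<theta>"
    have v1: "norm (v - 1) \<le> \<theta>" using iexp_approx1[of \<theta> 0] \<theta> by (simp add: v_def)
    have v3: "norm (v - (1 + \<i> * \<theta> - \<theta>\<^sup>2 / 2)) \<le> \<theta> ^ 3 / 6"
      using iexp_approx1[of \<theta> 2] \<theta>
      by (simp add: v_def numeral_2_eq_2 numeral_3_eq_3 power_mult_distrib algebra_simps)
    obtain E where E: "norm E \<le> C * norm (v - 1)" "main_pgf p n v = exp ((v - 1) * of_real s + E)"
      using main[OF n, of v] v1 \<theta> unfolding s_def by auto
    define D where "D = E + (v - (1 + \<i> * \<theta> - \<theta>\<^sup>2 / 2)) * of_real s"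
    have "norm D \<le> norm E + norm (v - (1 + \<i> * \<theta> - \<theta>\<^sup>2 / 2)) * s"
      unfolding D_def using s by (intro order.trans[OF norm_triangle_ineq]) (simp add: norm_mult)
    also have "\<dots> \<le> C * \<theta> + \<theta> ^ 3 / 6 * s"
      using E(1) v1 v3 C s by (intro add_mono mult_right_mono) (auto intro: order.trans mult_left_mono)
    also have "\<theta> ^ 3 / 6 * s = x / 6 * \<theta>" by (simp add: x_def power2_eq_square power3_eq_cube)
    finally have D: "norm D \<le> C * \<theta> + x / 6 * \<theta>" .
    have D1: "norm D \<le> \<theta> * ((C + 1) * (1 + x))"
    proof -
      have "C * \<theta> + x / 6 * \<theta> = \<theta> * (C + x / 6)" by (simp add: algebra_simps)
      also have "\<dots> \<le> \<theta> * ((C + 1) * (1 + x))"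
        using \<theta> C x by (intro mult_left_mono) (auto simp: algebra_simps intro!: add_nonneg_nonneg)
      finally show ?thesis using D by linarith
    qed
    have D2: "norm D \<le> C + x / 4"
    proof -
      have "C * \<theta> + x / 6 * \<theta> \<le> C * 1 + x / 6 * 1"
        using \<theta> C x by (intro add_mono mult_left_mono) auto
      thus ?thesis using D x by linarith
    qed
    have "main_pgf p n v * iexp (- \<theta> * s) = exp (((v - 1) * of_real s + E) + \<i> * of_real (- \<theta> * s))"
      by (simp only: E(2) exp_add)
    also have "((v - 1) * of_real s + E) + \<i> * of_real (- \<theta> * s) = of_real (- x / 2) + D"
      by (simp add: D_def x_def algebra_simps)
    finally have "main_pgf p n v * iexp (- \<theta> * s) = of_real (exp (- x / 2)) * exp D"
      by (simp only: exp_add exp_of_real)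
    hence "main_pgf p n v * iexp (- \<theta> * s) - exp (- s * \<theta>\<^sup>2 / 2) = of_real (exp (- x / 2)) * (exp D - 1)"
      by (simp add: x_def right_diff_distrib)
    hence "norm (main_pgf p n v * iexp (- \<theta> * s) - exp (- s * \<theta>\<^sup>2 / 2)) = exp (- x / 2) * norm (exp D - 1)"
      by (simp add: norm_mult)
    also have "\<dots> \<le> exp (- x / 2) * (\<theta> * ((C + 1) * (1 + x)) * exp (C + x / 4))"
      using D1 D2 by (intro mult_left_mono order.trans[OF norm_exp_minus_1_le] mult_mono)
        (auto intro: order.trans[OF norm_ge_zero])
    also have "\<dots> = \<theta> * (exp C * (C + 1)) * ((1 + x) * exp (- x / 4))"
    proof -
      have "exp (- x / 2) * exp (C + x / 4) = exp C * exp (- x / 4)"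
        by (simp flip: exp_add)
      thus ?thesis by (simp add: algebra_simps)
    qed
    also have "\<dots> \<le> \<theta> * (exp C * (C + 1)) * (32 / (1 + x))"
      using \<theta> C by (intro mult_left_mono exp_decay_bound x) auto
    also have "\<dots> = \<theta> * (K / (1 + s * \<theta>\<^sup>2))" by (simp add: K_def x_def)
    finally show "norm (main_pgf p n (iexp \<theta>) * iexp (- \<theta> * (2 * real p * ln (real n))) - exp (- (2 * real p * ln (real n)) * \<theta>\<^sup>2 / 2))
       \<le> \<theta> * (K / (1 + 2 * real p * ln (real n) * \<theta>\<^sup>2))"
      unfolding s_def v_def .
  qed (use C in \<open>simp add: K_def\<close>)
qed

text \<open>
  An error that is merely small would not survive division by \<open>\<theta>\<close> near 0. The remainder vanishes at
  \<open>v = 1\<close>, and its derivative is bounded by Cauchy's inequality, which supplies the factor \<open>\<theta>\<close>.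
\<close>

lemma passes_pgf_iexp:
  assumes p: "p \<ge> 1"
  shows "\<exists>\<delta>>0. \<exists>K\<ge>0. \<forall>n\<ge>p + 1. \<forall>\<theta>. 0 \<le> \<theta> \<longrightarrow> \<theta> \<le> \<delta> \<longrightarrow>
     norm (passes_pgf p n (iexp \<theta>) * iexp (- \<theta> * (2 * real p * ln (real n))) - exp (- (2 * real p * ln (real n)) * \<theta>\<^sup>2 / 2))
       \<le> \<theta> * (K / (1 + 2 * real p * ln (real n) * \<theta>\<^sup>2) + K / sqrt (ln (real n)))"
proof -
  obtain \<delta> K where \<delta>: "\<delta> > 0" "\<delta> \<le> 1/4" and K: "K > 0" and
    bound: "\<And>n v. n \<ge> p \<Longrightarrow> norm (v - 1) \<le> \<delta> \<Longrightarrow> norm (passes_pgf p n v - main_pgf p n v) \<le> K * real n powr (1/2 - 1)"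
    using passes_pgf_approx[OF p, of "1/2"] by auto
  obtain K' where K': "K' \<ge> 0" and
    main: "\<And>n \<theta>. n \<ge> 1 \<Longrightarrow> 0 \<le> \<theta> \<Longrightarrow> \<theta> \<le> 1/4 \<Longrightarrow>
      norm (main_pgf p n (iexp \<theta>) * iexp (- \<theta> * (2 * real p * ln (real n))) - exp (- (2 * real p * ln (real n)) * \<theta>\<^sup>2 / 2))
       \<le> \<theta> * (K' / (1 + 2 * real p * ln (real n) * \<theta>\<^sup>2))"
    using main_pgf_iexp[OF p] by blast
  \<comment> \<open>circles of radius \<open>r\<close> around points at distance at most \<open>r\<close> from 1 must stay in the good region\<close>
  define r where "r = \<delta> / 3"
  have r: "r > 0" "r \<le> 1/4" "2 * r < \<delta>" using \<delta> by (auto simp: r_def)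
  define L where "L = max K' (2 * K / r)"
  have L: "L \<ge> 0" using K' by (simp add: L_def)
  show ?thesis
  proof (rule exI[of _ r], intro conjI r(1), rule exI[of _ L], intro conjI L allI impI)
    fix n :: nat and \<theta> :: real assume n: "n \<ge> p + 1" and \<theta>: "0 \<le> \<theta>" "\<theta> \<le> r"
    have n2: "real n \<ge> 2" "n \<ge> p" "n \<ge> 1" using n p by auto
    have lnn: "ln (real n) > 0" using n2 by simp
    define s where "s = 2 * real p * ln (real n)"
    define v where "v = iexp \<theta>"
    have v1: "norm (v - 1) \<le> \<theta>" using iexp_approx1[of \<theta> 0] \<theta> by (simp add: v_def)
    define f where "f = (\<lambda>v. passes_pgf p n v - main_pgf p n v)"
    define B where "B = 2 * K * real n powr (1/2 - 1)"
    have hol: "f holomorphic_on ball 1 (1/4)"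
    proof -
      have "passes_pgf p n holomorphic_on ball 1 (1/4)"
        unfolding passes_pgf_eq[OF n2(2)] by (rule pgf_derivs_at_1[OF finite_mqs_input[OF n2(2)]])
      thus ?thesis unfolding f_def by (intro holomorphic_on_diff main_pgf_holomorphic)
    qed
    have fB: "norm (f u) < B" if "norm (u - 1) \<le> \<delta>" for u
    proof -
      have "norm (f u) \<le> K * real n powr (1/2 - 1)" unfolding f_def by (rule bound[OF n2(2) that])
      also have "\<dots> < B" using K n2 by (simp add: B_def)
      finally show ?thesis .
    qed
    have f1: "f 1 = 0"
      using n2 by (simp add: f_def passes_pgf_def passes_gf_1)
    have "norm (f v - f 1) \<le> B / r * norm (v - 1)"
    proof (rule field_differentiable_bound[of "cball 1 r" f "deriv f"])
      fix u :: complex assume u: "u \<in> cball 1 r"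
      hence ball: "u \<in> ball 1 (1/4)" using r \<delta> by (auto simp: dist_norm)
      show "(f has_field_derivative deriv f u) (at u within cball 1 r)"
        using holomorphic_derivI[OF hol _ ball] by (rule DERIV_subset) auto
      have sub: "cball u r \<subseteq> cball 1 (2 * r)"
      proof
        fix w assume "w \<in> cball u r"
        thus "w \<in> cball 1 (2 * r)" using u dist_triangle[of 1 w u] by (simp add: dist_commute)
      qed
      have sub': "cball u r \<subseteq> ball 1 (1/4)" using sub r \<delta> by force
      have "norm ((deriv ^^ 1) f u) \<le> fact 1 * B / r ^ 1"
      proof (rule Cauchy_higher_deriv_bound)
        show "f holomorphic_on ball u r"
          by (rule holomorphic_on_subset[OF hol]) (use sub' in \<open>auto intro: less_imp_le\<close>)
        show "continuous_on (cball u r) f"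
          by (rule holomorphic_on_imp_continuous_on[OF holomorphic_on_subset[OF hol sub']])
        fix w assume "w \<in> ball u r"
        hence "w \<in> cball u r" by auto
        hence "w \<in> cball 1 (2 * r)" using sub by blast
        hence "norm (w - 1) \<le> \<delta>" using r by (simp add: dist_norm norm_minus_commute)
        thus "f w \<in> ball 0 B" using fB by simp
      qed (use r in auto)
      thus "norm (deriv f u) \<le> B / r" by simp
    qed (use v1 \<theta> r in \<open>auto simp: dist_norm norm_minus_commute\<close>)
    also have "B / r * norm (v - 1) \<le> B / r * \<theta>"
      using v1 K r by (intro mult_left_mono) (auto simp: B_def)
    finally have "norm (f v) \<le> B / r * \<theta>" by (simp add: f1)
    also have "B / r = 2 * K / r * real n powr (- 1/2)" by (simp add: B_def)
    also have "real n powr (- 1/2) \<le> 1 / sqrt (ln (real n))"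
    proof -
      have "real n powr (- 1/2) = 1 / sqrt (real n)"
        using n2 by (simp add: powr_minus_divide powr_half_sqrt)
      also have "\<dots> \<le> 1 / sqrt (ln (real n))"
        using lnn n2 ln_le_minus_one[of "real n"] by (intro divide_left_mono real_sqrt_le_mono) auto
      finally show ?thesis .
    qed
    hence "2 * K / r * real n powr (- 1/2) * \<theta> \<le> 2 * K / r * (1 / sqrt (ln (real n))) * \<theta>"
      using K r \<theta> by (intro mult_right_mono mult_left_mono) auto
    also have "\<dots> \<le> L * (1 / sqrt (ln (real n))) * \<theta>"
      using \<theta> lnn by (intro mult_right_mono) (auto simp: L_def)
    finally have f: "norm (f v) \<le> L * (1 / sqrt (ln (real n))) * \<theta>" by simp
    have "norm (passes_pgf p n v * iexp (- \<theta> * s) - exp (- s * \<theta>\<^sup>2 / 2)) =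
          norm ((main_pgf p n v * iexp (- \<theta> * s) - exp (- s * \<theta>\<^sup>2 / 2)) + f v * iexp (- \<theta> * s))"
      by (simp add: f_def algebra_simps)
    also have "\<dots> \<le> norm (main_pgf p n v * iexp (- \<theta> * s) - exp (- s * \<theta>\<^sup>2 / 2)) + norm (f v)"
      by (rule order.trans[OF norm_triangle_ineq]) (simp only: norm_mult norm_exp_i_times mult_1_right order.refl)
    also have "\<dots> \<le> \<theta> * (K' / (1 + s * \<theta>\<^sup>2)) + L * (1 / sqrt (ln (real n))) * \<theta>"
      using main[OF n2(3) \<theta>(1)] \<theta>(2) r f unfolding v_def s_def by (intro add_mono) auto
    also have "\<dots> \<le> \<theta> * (L / (1 + s * \<theta>\<^sup>2)) + L * (1 / sqrt (ln (real n))) * \<theta>"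
      using \<theta> lnn by (intro add_right_mono mult_left_mono divide_right_mono) (auto simp: L_def s_def intro!: add_nonneg_nonneg)
    also have "\<dots> = \<theta> * (L / (1 + s * \<theta>\<^sup>2) + L / sqrt (ln (real n)))" by (simp add: algebra_simps)
    finally show "norm (passes_pgf p n (iexp \<theta>) * iexp (- \<theta> * (2 * real p * ln (real n))) - exp (- (2 * real p * ln (real n)) * \<theta>\<^sup>2 / 2))
       \<le> \<theta> * (L / (1 + 2 * real p * ln (real n) * \<theta>\<^sup>2) + L / sqrt (ln (real n)))"
      unfolding s_def v_def .
  qed
qed

section \<open>Esseen's smoothing inequality\<close>

text \<open>
  Up to normalisation, the Fejer kernel: an integrable nonnegative function whose Fourier transform is
  supported in \<open>[-1, 1]\<close>.
\<close>

definition fejer :: "real \<Rightarrow> real" where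
  "fejer s = (sinc (s / 2))\<^sup>2"

lemma fejer_measurable [measurable]: "fejer \<in> borel_measurable borel"
  unfolding fejer_def by measurable

lemma fejer_nonneg [simp]: "0 \<le> fejer s"
  by (simp add: fejer_def)

lemma fejer_le: "fejer s \<le> 5 * inverse (1 + s\<^sup>2)"
proof (cases "s = 0")
  case False
  have "(sin (s/2))\<^sup>2 \<le> (s/2)\<^sup>2"
    using abs_sin_x_le_abs_x[of "s/2"] unfolding abs_le_square_iff .
  moreover have "(sin (s/2))\<^sup>2 \<le> 1"
    by (simp add: abs_square_le_1)
  ultimately have "4 * (sin (s/2))\<^sup>2 * (1 + s\<^sup>2) \<le> 5 * s\<^sup>2"
    using mult_right_mono[of "(sin (s/2))\<^sup>2" 1 "s\<^sup>2"] by (simp add: algebra_simps power_divide)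
  moreover have "1 + s\<^sup>2 > 0" by (simp add: add_pos_nonneg)
  ultimately show ?thesis
    using False by (simp add: fejer_def power_divide field_simps)
qed (simp add: fejer_def)

lemma fejer_integrable: "integrable lborel fejer"
proof (rule Bochner_Integration.integrable_bound)
  show "integrable lborel (\<lambda>s::real. 5 * inverse (1 + s\<^sup>2))"
    using integrable_inverse_1_plus_square by (simp add: set_integrable_def)
  show "AE x in lborel. norm (fejer x) \<le> norm (5 * inverse (1 + x\<^sup>2))"
    using fejer_le by (intro AE_I2) (simp add: order.trans[OF _ abs_ge_self])
qed simp

text \<open>
  The only way in which the kernel enters Fourier analysis: it is the transform of the tent function.
\<close>

lemma fejer_eq_integral: "fejer s = (LINT t:{0..1}|lborel. 2 * (1 - t) * cos (t * s))"
proof (cases "s = 0")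
  case True
  have "(LINT t:{0..1}|lborel. 2 * (1 - t :: real)) = (2 * 1 - 1\<^sup>2) - (2 * 0 - 0\<^sup>2)"
    unfolding set_lebesgue_integral_def
    by (rule integral_FTC_atLeastAtMost)
       (auto simp: has_real_derivative_iff_has_vector_derivative [symmetric]
             intro!: derivative_eq_intros continuous_intros)
  thus ?thesis using True by (simp add: fejer_def)
next
  case False
  let ?F = "\<lambda>t. 2 * ((1 - t) * sin (t * s) / s - cos (t * s) / s\<^sup>2)"
  have "(LINT t:{0..1}|lborel. 2 * (1 - t) * cos (t * s)) = ?F 1 - ?F 0"
    unfolding set_lebesgue_integral_def
    by (rule integral_FTC_atLeastAtMost)
       (use False in \<open>auto simp: has_real_derivative_iff_has_vector_derivative [symmetric] field_simps power2_eq_square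
             intro!: derivative_eq_intros continuous_intros\<close>)
  also have "\<dots> = 2 * (1 - cos s) / s\<^sup>2" using False by (simp add: field_simps)
  also have "cos s = 1 - 2 * (sin (s/2))\<^sup>2" using cos_double_sin[of "s/2"] by simp
  finally show ?thesis using False by (simp add: fejer_def power_divide field_simps)
qed

lemma fejer_ge_half:
  assumes "\<bar>s\<bar> \<le> 1" shows "1/2 \<le> fejer s"
proof -
  have "1/2 = (LINT t:{0..1}|lborel. (1 - t :: real))"
  proof -
    have "(LINT t:{0..1}|lborel. (1 - t :: real)) = (1 - 1\<^sup>2/2) - (0 - 0\<^sup>2/2)"
      unfolding set_lebesgue_integral_def
      by (rule integral_FTC_atLeastAtMost)
         (auto simp: has_real_derivative_iff_has_vector_derivative [symmetric]
               intro!: derivative_eq_intros continuous_intros)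
    thus ?thesis by simp
  qed
  also have "\<dots> \<le> (LINT t:{0..1}|lborel. 2 * (1 - t) * cos (t * s))"
  proof (rule set_integral_mono)
    fix t :: real assume t: "t \<in> {0..1}"
    have "\<bar>t * s\<bar> \<le> 1 * 1" unfolding abs_mult using t assms by (intro mult_mono) auto
    hence "cos (pi/3) \<le> cos \<bar>t * s\<bar>" using pi_gt3 by (intro cos_monotone_0_pi_le) auto
    hence "1/2 \<le> cos (t * s)" by (simp add: cos_60)
    thus "1 - t \<le> 2 * (1 - t) * cos (t * s)"
      using t mult_left_mono[of "1/2" "cos (t * s)" "2 * (1 - t)"] by simp
  qed (auto intro!: borel_integrable_atLeastAtMost' continuous_intros)
  finally show ?thesis by (simp add: fejer_eq_integral)
qed

definition fejer_measure :: "real measure" where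
  "fejer_measure = density lborel (\<lambda>s. ennreal (fejer s))"

lemma sets_fejer [measurable_cong, simp]: "sets fejer_measure = sets borel"
  and space_fejer [simp]: "space fejer_measure = UNIV"
  by (auto simp: fejer_measure_def)

lemma finite_measure_fejer: "finite_measure fejer_measure"
proof (rule finite_measureI)
  have "(\<integral>\<^sup>+ s. ennreal (fejer s) \<partial>lborel) = ennreal (LINT s|lborel. fejer s)"
    by (rule nn_integral_eq_integral) (auto intro: fejer_integrable)
  thus "emeasure fejer_measure (space fejer_measure) \<noteq> \<infinity>"
    by (simp add: fejer_measure_def emeasure_density)
qed

interpretation fejer: finite_measure fejer_measure by (rule finite_measure_fejer)

lemma fejer_mass_pos: "0 < measure fejer_measure UNIV"
proof -
  have "emeasure lborel {-1..1::real} * ennreal (1/2) \<le> emeasure fejer_measure {-1..1}"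
  proof -
    have "emeasure lborel {-1..1::real} * ennreal (1/2) = (\<integral>\<^sup>+s. ennreal (1/2) * indicator {-1..1::real} s \<partial>lborel)"
      by (simp add: nn_integral_cmult_indicator mult.commute)
    also have "\<dots> \<le> (\<integral>\<^sup>+s. ennreal (fejer s) * indicator {-1..1} s \<partial>lborel)"
    proof (rule nn_integral_mono)
      fix s :: real
      have "ennreal (1/2) \<le> ennreal (fejer s)" if "s \<in> {-1..1}"
        using that by (intro ennreal_leI fejer_ge_half) auto
      thus "ennreal (1/2) * indicator {-1..1::real} s \<le> ennreal (fejer s) * indicator {-1..1} s"
        by (auto split: split_indicator)
    qed
    finally show ?thesis by (simp add: fejer_measure_def emeasure_density)
  qed
  hence "emeasure fejer_measure {-1..1} \<noteq> 0"
    by (auto simp: ennreal_mult[symmetric])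
  hence "measure fejer_measure {-1..1} > 0"
    by (simp add: fejer.emeasure_eq_measure zero_less_measure_iff)
  thus ?thesis using fejer.finite_measure_mono[of "{-1..1}" UNIV] by simp
qed

lemma finite_Fubini:
  fixes f :: "'a \<Rightarrow> 'b \<Rightarrow> real"
  assumes "finite_measure M" "finite_measure N"
    and meas: "case_prod f \<in> borel_measurable (M \<Otimes>\<^sub>M N)"
    and bound: "\<And>x y. x \<in> space M \<Longrightarrow> y \<in> space N \<Longrightarrow> \<bar>f x y\<bar> \<le> C"
  shows "(LINT x|M. LINT y|N. f x y) = (LINT y|N. LINT x|M. f x y)"
proof -
  interpret M: finite_measure M by fact
  interpret N: finite_measure N by fact
  interpret pair_sigma_finite M N ..
  interpret P: finite_measure "M \<Otimes>\<^sub>M N" by (rule finite_measure_pair_measure) fact+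
  have "integrable (M \<Otimes>\<^sub>M N) (case_prod f)"
    by (rule P.integrable_const_bound[of _ C])
       (use meas bound in \<open>auto simp: space_pair_measure\<close>)
  thus ?thesis by (rule Fubini_integral [symmetric])
qed

lemma measurable_pair_ident:
  fixes f :: "real \<Rightarrow> real \<Rightarrow> real"
  assumes "case_prod f \<in> borel_measurable (borel \<Otimes>\<^sub>M borel)"
    and "(\<lambda>x. x) \<in> measurable M borel" "(\<lambda>x. x) \<in> measurable N borel"
  shows "case_prod f \<in> borel_measurable (M \<Otimes>\<^sub>M N)"
  using measurable_compose[OF measurable_Pair[OF measurable_compose[OF measurable_fst assms(2)]
          measurable_compose[OF measurable_snd assms(3)]] assms(1)]
  by (simp add: split_beta')

lemma measurable_ident_restrict: "(\<lambda>x. x) \<in> measurable (restrict_space lborel A) (borel :: real measure)"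
  by (rule measurable_restrict_space1) simp

lemma finite_measure_restrict_Icc: "finite_measure (restrict_space lborel {a..b::real})"
  by (rule finite_measureI) (cases "a \<le> b", auto simp: emeasure_restrict_space space_restrict_space)

text \<open>
  The cosine transform of an interval; it decays like \<open>1/t\<close>, which is the origin of the weight
  \<open>1/t\<close> in the smoothing inequality.
\<close>

definition window :: "real \<Rightarrow> real \<Rightarrow> real \<Rightarrow> real \<Rightarrow> real" where
  "window a b u t = (LINT y:{a..b}|lborel. cos (t * (u - y)))"

lemma window_eq:
  assumes "a \<le> b" "t \<noteq> 0"
  shows "window a b u t = (sin (t * (u - a)) - sin (t * (u - b))) / t"
proof -
  have "window a b u t = - (sin (t * (u - b)) / t) - - (sin (t * (u - a)) / t)"
    unfolding window_def set_lebesgue_integral_def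
    by (rule integral_FTC_atLeastAtMost)
       (use assms in \<open>auto simp: has_real_derivative_iff_has_vector_derivative [symmetric] field_simps
             intro!: derivative_eq_intros continuous_intros\<close>)
  thus ?thesis by (simp add: diff_divide_distrib)
qed

lemma window_bound:
  assumes "a \<le> b" shows "\<bar>window a b u t\<bar> \<le> b - a"
proof -
  have int: "set_integrable lborel {a..b} (\<lambda>y. cos (t * (u - y)))"
    by (intro borel_integrable_atLeastAtMost' continuous_intros)
  have "\<bar>window a b u t\<bar> \<le> (LINT y:{a..b}|lborel. \<bar>cos (t * (u - y))\<bar>)"
    using set_integral_norm_bound[OF int] by (simp add: window_def)
  also have "\<dots> \<le> (LINT y:{a..b}|lborel. 1)"
    by (rule set_integral_mono) (auto intro!: borel_integrable_atLeastAtMost' continuous_intros)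
  finally show ?thesis using assms by (simp add: set_lebesgue_integral_def)
qed

lemma fejer_interval:
  assumes "a \<le> b"
  shows "(LINT s|fejer_measure. indicator {a..b} (u - s)) =
         (LINT t:{0..1}|lborel. 2 * (1 - t) * window a b u t)"
proof -
  have "(LINT s|fejer_measure. indicator {a..b} (u - s)) = (LINT s|lborel. fejer s * indicator {a..b} (u - s))"
    unfolding fejer_measure_def by (subst integral_density) auto
  also have "\<dots> = (LINT y|lborel. fejer (u - y) * indicator {a..b} y)"
    by (subst lborel_integral_real_affine[of "-1" _ u]) (auto simp: algebra_simps)
  also have "\<dots> = (LINT y:{a..b}|lborel. LINT t:{0..1}|lborel. 2 * (1 - t) * cos (t * (u - y)))"
    unfolding fejer_eq_integral [symmetric] by (simp add: set_lebesgue_integral_def mult.commute)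
  also have "\<dots> = (LINT y|restrict_space lborel {a..b}. LINT t|restrict_space lborel {0..1}. 2 * (1 - t) * cos (t * (u - y)))"
    by (simp add: set_lebesgue_integral_def integral_restrict_space)
  also have "\<dots> = (LINT t|restrict_space lborel {0..1}. LINT y|restrict_space lborel {a..b}. 2 * (1 - t) * cos (t * (u - y)))"
  proof (rule finite_Fubini[where C = 2])
    fix y t :: real assume "t \<in> space (restrict_space lborel {0..1})"
    hence "t \<in> {0..1}" by (simp add: space_restrict_space)
    hence "2 * \<bar>1 - t\<bar> * \<bar>cos (t * (u - y))\<bar> \<le> 2 * 1 * 1" by (intro mult_mono) auto
    thus "\<bar>2 * (1 - t) * cos (t * (u - y))\<bar> \<le> 2"
      by (simp only: abs_mult abs_numeral mult_1_right)
  next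
    show "(\<lambda>(y, t). 2 * (1 - t) * cos (t * (u - y)))
            \<in> borel_measurable (restrict_space lborel {a..b} \<Otimes>\<^sub>M restrict_space lborel {0..1})"
      by (rule measurable_pair_ident[OF _ measurable_ident_restrict measurable_ident_restrict]) measurable
  qed (rule finite_measure_restrict_Icc)+
  also have "\<dots> = (LINT t|restrict_space lborel {0..1}. 2 * (1 - t) * (LINT y|restrict_space lborel {a..b}. cos (t * (u - y))))"
    by simp
  also have "\<dots> = (LINT t:{0..1}|lborel. 2 * (1 - t) * window a b u t)"
    by (simp add: set_lebesgue_integral_def integral_restrict_space window_def)
  finally show ?thesis .
qed

lemma window_measurable [measurable]: "(\<lambda>(u, t). window a b u t) \<in> borel_measurable (borel \<Otimes>\<^sub>M borel)"
  unfolding window_def set_lebesgue_integral_def by measurable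

text \<open>
  Probabilities of randomly shifted intervals depend on the characteristic function in \<open>[0, 1]\<close> only.
\<close>

lemma (in real_distribution) fejer_smoothed_interval:
  assumes "a \<le> b"
  shows "(LINT s|fejer_measure. measure M {a+s..b+s}) =
         (LINT t:{0..1}|lborel. 2 * (1 - t) * (LINT u|M. window a b u t))"
proof -
  have "(LINT s|fejer_measure. measure M {a+s..b+s}) = (LINT s|fejer_measure. LINT u|M. indicator {a..b} (u - s))"
  proof (intro Bochner_Integration.integral_cong refl)
    fix s
    have "(LINT u|M. indicator {a..b} (u - s)) = (LINT u|M. indicator {a+s..b+s} u :: real)"
      by (intro Bochner_Integration.integral_cong refl) (auto simp: indicator_def)
    thus "measure M {a+s..b+s} = (LINT u|M. indicator {a..b} (u - s))" by simp
  qed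
  also have "\<dots> = (LINT u|M. LINT s|fejer_measure. indicator {a..b} (u - s))"
    by (rule finite_Fubini[where C = 1]) (auto intro: finite_measure_fejer finite_measure_axioms simp: indicator_def)
  also have "\<dots> = (LINT u|M. LINT t|restrict_space lborel {0..1}. 2 * (1 - t) * window a b u t)"
    unfolding fejer_interval[OF assms]
    by (simp add: set_lebesgue_integral_def integral_restrict_space)
  also have "\<dots> = (LINT t|restrict_space lborel {0..1}. LINT u|M. 2 * (1 - t) * window a b u t)"
  proof (rule finite_Fubini[where C = "2 * 1 * (b - a)"])
    fix u t :: real assume "t \<in> space (restrict_space lborel {0..1})"
    hence "t \<in> {0..1}" by (simp add: space_restrict_space)
    thus "\<bar>2 * (1 - t) * window a b u t\<bar> \<le> 2 * 1 * (b - a)"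
      unfolding abs_mult using assms window_bound[OF assms] by (intro mult_mono) auto
  next
    have "(\<lambda>u. u) \<in> measurable M borel" by (rule measurable_ident_sets) simp
    thus "(\<lambda>(u, t). 2 * (1 - t) * window a b u t) \<in> borel_measurable (M \<Otimes>\<^sub>M restrict_space lborel {0..1})"
      by (intro measurable_pair_ident[OF _ _ measurable_ident_restrict]) measurable
  qed (rule finite_measure_restrict_Icc finite_measure_axioms)+
  also have "\<dots> = (LINT t|restrict_space lborel {0..1}. 2 * (1 - t) * (LINT u|M. window a b u t))"
    by simp
  finally show ?thesis by (simp add: set_lebesgue_integral_def integral_restrict_space)
qed

lemma (in real_distribution) integral_window:
  assumes "a \<le> b" "t \<noteq> 0"
  shows "(LINT u|M. window a b u t) = Im (char M t * (iexp (- t * a) - iexp (- t * b))) / t"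
proof -
  have int: "integrable M (\<lambda>u. iexp (t * u))" by (rule integrable_iexp) auto
  have "Im (char M t * (iexp (- t * a) - iexp (- t * b))) =
        Im (LINT u|M. iexp (t * u) * (iexp (- t * a) - iexp (- t * b)))"
    unfolding char_def using int by simp
  also have "\<dots> = (LINT u|M. Im (iexp (t * u) * (iexp (- t * a) - iexp (- t * b))))"
    using int by (intro integral_Im [symmetric]) simp
  also have "\<dots> = (LINT u|M. sin (t * (u - a)) - sin (t * (u - b)))"
    by (intro Bochner_Integration.integral_cong refl)
       (simp add: Re_exp Im_exp sin_diff algebra_simps)
  finally show ?thesis using assms by (simp add: window_eq)
qed

text \<open>
  For intervals \<open>[a, b]\<close> the bound follows from the integral representation, with a factor 2 for the two
  end points; \<open>a\<close> is then sent to \<open>-\<infinity>\<close> by dominated convergence. Starting from bounded intervals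
  avoids the singularity of the representation of a distribution function at \<open>t = 0\<close>.
\<close>

lemma fejer_smoothing_bound:
  assumes M: "real_distribution M" and N: "real_distribution N"
    and g: "set_integrable lborel {0..1} g"
    and le: "\<And>t. 0 < t \<Longrightarrow> t \<le> 1 \<Longrightarrow> norm (char M t - char N t) \<le> t * g t"
  shows "\<bar>LINT s|fejer_measure. (cdf M (b + s) - cdf N (b + s))\<bar> \<le> 4 * (LINT t:{0..1}|lborel. g t)"
proof -
  interpret M: real_distribution M by fact
  interpret N: real_distribution N by fact
  have meas: "(\<lambda>s. measure L {x+s..b+s}) \<in> borel_measurable fejer_measure" 
    if "real_distribution L" for L x
  proof -
    interpret L: real_distribution L by fact
    have "measure L {x+s..b+s} = (LINT u|L. (if x + s \<le> u \<and> u \<le> b + s then 1 else 0))" for s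
    proof -
      have "(LINT u|L. (if x + s \<le> u \<and> u \<le> b + s then 1 else 0)) = (LINT u|L. indicator {x+s..b+s} u :: real)"
        by (intro Bochner_Integration.integral_cong refl) (auto simp: indicator_def)
      thus ?thesis by simp
    qed
    thus ?thesis by simp
  qed
  have lim: "(\<lambda>n. LINT s|fejer_measure. measure L {- real n + s..b+s}) \<longlonglongrightarrow> (LINT s|fejer_measure. cdf L (b + s))"
    if "real_distribution L" for L
  proof -
    interpret L: real_distribution L by fact
    show ?thesis
    proof (rule integral_dominated_convergence[where w = "\<lambda>_. 1"])
      show "AE s in fejer_measure. (\<lambda>n. measure L {- real n + s..b + s}) \<longlonglongrightarrow> cdf L (b + s)"
      proof (rule AE_I2)
        fix s :: real
        have "(\<lambda>n. measure L {- real n + s..b + s}) \<longlonglongrightarrow> measure L (\<Union>n. {- real n + s..b + s})"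
          by (rule L.finite_Lim_measure_incseq) (auto simp: incseq_def)
        also have "(\<Union>n. {- real n + s..b + s}) = {..b + s}"
        proof (intro equalityI subsetI)
          fix x assume "x \<in> {..b + s}"
          moreover obtain n where "s - x \<le> real n" using real_arch_simple by blast
          ultimately show "x \<in> (\<Union>n. {- real n + s..b + s})" by (auto intro!: exI[of _ n])
        qed auto
        finally show "(\<lambda>n. measure L {- real n + s..b + s}) \<longlonglongrightarrow> cdf L (b + s)" by (simp add: cdf_def)
      qed
      have "mono (cdf L)" using L.cdf_nondecreasing by (auto simp: mono_def)
      from borel_measurable_mono[OF this] have [measurable]: "cdf L \<in> borel_measurable borel" .
      show "(\<lambda>s. cdf L (b + s)) \<in> borel_measurable fejer_measure" by measurable
      show "(\<lambda>s. measure L {- real n + s..b+s}) \<in> borel_measurable fejer_measure" for n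
        by (rule meas[OF that])
    qed auto
  qed
  have bound: "\<bar>(LINT s|fejer_measure. measure M {a+s..b+s}) - (LINT s|fejer_measure. measure N {a+s..b+s})\<bar>
              \<le> 4 * (LINT t:{0..1}|lborel. g t)" if ab: "a \<le> b" for a
  proof -
    define w where "w = (\<lambda>L t. 2 * (1 - t) * (LINT u|L. window a b u t))"
    have int: "set_integrable lborel {0..1} (w L)" if "real_distribution L" for L
    proof -
      interpret L: real_distribution L by fact
      have [measurable]: "(\<lambda>t. LINT u|L. window a b u t) \<in> borel_measurable borel"
        by measurable
      have wb: "\<bar>LINT u|L. window a b u t\<bar> \<le> b - a" for t
      proof -
        have "\<bar>LINT u|L. window a b u t\<bar> \<le> (LINT u|L. b - a)"
          by (rule integral_abs_bound[THEN order.trans], rule integral_mono)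
             (use window_bound[OF ab] in \<open>auto intro!: L.integrable_const_bound[of _ "b - a"]\<close>)
        thus ?thesis by (simp del: L.space_eq_univ add: L.prob_space)
      qed
      show ?thesis unfolding set_integrable_def
      proof (rule Bochner_Integration.integrable_bound)
        show "integrable lborel (\<lambda>t. indicator {0..1::real} t *\<^sub>R (2 * 1 * (b - a)))"
          by simp
        show "AE t in lborel. norm (indicator {0..1} t *\<^sub>R w L t) \<le> norm (indicator {0..1::real} t *\<^sub>R (2 * 1 * (b - a)))"
        proof (rule AE_I2)
          fix t :: real
          have "\<bar>w L t\<bar> \<le> 2 * 1 * (b - a)" if "t \<in> {0..1}"
            unfolding w_def abs_mult using that ab wb by (intro mult_mono) auto
          thus "norm (indicator {0..1} t *\<^sub>R w L t) \<le> norm (indicator {0..1::real} t *\<^sub>R (2 * 1 * (b - a)))"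
            using ab by (auto split: split_indicator)
        qed
      qed (simp add: w_def)
    qed
    have "(LINT s|fejer_measure. measure M {a+s..b+s}) - (LINT s|fejer_measure. measure N {a+s..b+s}) =
          (LINT t:{0..1}|lborel. w M t - w N t)"
      using M.fejer_smoothed_interval[OF ab] N.fejer_smoothed_interval[OF ab] int[OF M] int[OF N]
      by (simp add: w_def)
    also have "\<bar>\<dots>\<bar> \<le> (LINT t:{0..1}|lborel. 4 * g t)"
    proof -
      have pt: "\<bar>w M t - w N t\<bar> \<le> 4 * g t" if t: "0 < t" "t \<le> 1" for t
      proof -
        have "(LINT u|M. window a b u t) - (LINT u|N. window a b u t) =
              Im ((char M t - char N t) * (iexp (- t * a) - iexp (- t * b))) / t"
          using t by (simp add: M.integral_window[OF ab] N.integral_window[OF ab] field_simps)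
        also have "\<bar>\<dots>\<bar> \<le> norm ((char M t - char N t) * (iexp (- t * a) - iexp (- t * b))) / t"
          unfolding abs_divide using t by (intro frac_le abs_Im_le_cmod) auto
        also have "\<dots> \<le> (t * g t) * 2 / t"
        proof (intro divide_right_mono)
          have "norm (iexp (- t * a) - iexp (- t * b)) \<le> 1 + 1"
            using norm_triangle_ineq4[of "iexp (- t * a)" "iexp (- t * b)"] by (simp only: norm_exp_i_times)
          thus "norm ((char M t - char N t) * (iexp (- t * a) - iexp (- t * b))) \<le> t * g t * 2"
            unfolding norm_mult using le[OF t] by (intro mult_mono) (auto intro: order.trans[OF norm_ge_zero])
        qed (use t in auto)
        also have "\<dots> = 2 * g t" using t by simp
        finally have "2 * (1 - t) * \<bar>(LINT u|M. window a b u t) - (LINT u|N. window a b u t)\<bar> \<le> 2 * 1 * (2 * g t)"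
          using t by (intro mult_mono) auto
        moreover have "w M t - w N t = 2 * (1 - t) * ((LINT u|M. window a b u t) - (LINT u|N. window a b u t))"
          by (simp add: w_def algebra_simps)
        ultimately show ?thesis using t by (simp add: abs_mult)
      qed
      have "set_integrable lborel {0..1} (\<lambda>t. w M t - w N t)"
        using int[OF M] int[OF N] by (rule set_integral_diff)
      moreover have "set_integrable lborel {0..1} (\<lambda>t. 4 * g t)" using g by simp
      ultimately show ?thesis unfolding set_lebesgue_integral_def set_integrable_def
      proof (intro order.trans[OF integral_abs_bound] integral_mono_AE)
        show "AE t in lborel. \<bar>indicator {0..1} t *\<^sub>R (w M t - w N t)\<bar> \<le> indicator {0..1} t *\<^sub>R (4 * g t)"
          using AE_lborel_singleton[of 0] by eventually_elim (use pt in \<open>auto split: split_indicator\<close>)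
      qed auto
    qed
    finally show ?thesis by simp
  qed
  have "(\<lambda>n. \<bar>(LINT s|fejer_measure. measure M {- real n+s..b+s}) - (LINT s|fejer_measure. measure N {- real n+s..b+s})\<bar>)
        \<longlonglongrightarrow> \<bar>(LINT s|fejer_measure. cdf M (b + s)) - (LINT s|fejer_measure. cdf N (b + s))\<bar>"
    by (intro tendsto_intros lim M N)
  moreover obtain n0 where "- b \<le> real n0" using real_arch_simple by blast
  hence "eventually (\<lambda>n. \<bar>(LINT s|fejer_measure. measure M {- real n+s..b+s}) - (LINT s|fejer_measure. measure N {- real n+s..b+s})\<bar>
            \<le> 4 * (LINT t:{0..1}|lborel. g t)) sequentially"
    by (intro eventually_sequentiallyI[of n0] bound) linarith
  ultimately have "\<bar>(LINT s|fejer_measure. cdf M (b + s)) - (LINT s|fejer_measure. cdf N (b + s))\<bar> \<le> 4 * (LINT t:{0..1}|lborel. g t)"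
    by (rule tendsto_upperbound) simp
  moreover have "integrable fejer_measure (\<lambda>s. cdf L (b + s))" if "real_distribution L" for L
  proof -
    interpret L: real_distribution L by fact
    have "mono (cdf L)" using L.cdf_nondecreasing by (auto simp: mono_def)
    from borel_measurable_mono[OF this] have [measurable]: "cdf L \<in> borel_measurable borel" .
    show ?thesis
      by (rule fejer.integrable_const_bound[of _ 1]) (auto simp: L.cdf_nonneg L.cdf_bounded_prob)
  qed
  ultimately show ?thesis using M N by simp
qed

text \<open>
  If the two distribution functions differ by \<open>d\<close> at a point, monotonicity of one and the Lipschitz bound
  of the other keep them apart by almost \<open>d\<close> on a whole interval to the right or to the left, depending on
  the sign. With the kernel centred there, averaging still sees most of \<open>d\<close>, and outside the interval the
  kernel has so little mass that the supremum of the difference can be absorbed. The frequency range is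
  normalised to \<open>[0, 1]\<close>; other ranges are obtained by scaling the random variables.
\<close>

lemma Esseen_smoothing_unit:
  "\<exists>C>0. \<forall>M N g m x. real_distribution M \<longrightarrow> real_distribution N \<longrightarrow>
     (\<forall>x y. \<bar>cdf N x - cdf N y\<bar> \<le> m * \<bar>x - y\<bar>) \<longrightarrow> set_integrable lborel {0..1} g \<longrightarrow>
     (\<forall>t. 0 < t \<longrightarrow> t \<le> 1 \<longrightarrow> norm (char M t - char N t) \<le> t * g t) \<longrightarrow>
     \<bar>cdf M x - cdf N x\<bar> \<le> C * ((LINT t:{0..1}|lborel. g t) + m)"
proof -
  define c where "c = measure fejer_measure UNIV"
  have c: "c > 0" unfolding c_def by (rule fejer_mass_pos)
  obtain A where A: "A > 0" "measure fejer_measure (- {-A..A}) \<le> c / 8"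
  proof -
    have "(\<lambda>n. measure fejer_measure {- real n..real n}) \<longlonglongrightarrow> measure fejer_measure (\<Union>n. {- real n..real n})"
      by (rule fejer.finite_Lim_measure_incseq) (auto simp: incseq_def)
    also have "(\<Union>n. {- real n..real n}) = UNIV"
    proof (intro equalityI subsetI)
      fix x :: real
      obtain n where "\<bar>x\<bar> \<le> real n" using real_arch_simple by blast
      thus "x \<in> (\<Union>n. {- real n..real n})" by (auto intro!: exI[of _ n])
    qed auto
    finally have "(\<lambda>n. measure fejer_measure {- real n..real n}) \<longlonglongrightarrow> c" by (simp add: c_def)
    hence "eventually (\<lambda>n. measure fejer_measure {- real n..real n} > c - c / 8) sequentially"
      using c by (intro order_tendstoD) auto
    moreover have "eventually (\<lambda>n. n > 0) sequentially" by (rule eventually_gt_at_top)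
    ultimately have "eventually (\<lambda>n. n > 0 \<and> measure fejer_measure {- real n..real n} > c - c / 8) sequentially"
      by eventually_elim auto
    then obtain n where "n > 0" "measure fejer_measure {- real n..real n} > c - c / 8"
      by (auto simp: eventually_sequentially)
    moreover have "measure fejer_measure (- {- real n..real n}) = c - measure fejer_measure {- real n..real n}"
      using fejer.finite_measure_compl[of "{- real n..real n}"] by (simp add: c_def Compl_eq_Diff_UNIV)
    ultimately show ?thesis by (intro that[of "real n"]) auto
  qed
  \<comment> \<open>solving \<open>\<eta> \<le> 2 A m + 32 J / (7 c) + \<eta> / 7\<close> for the supremum \<open>\<eta>\<close>\<close>
  define C where "C = 7/6 * (2 * A + 32 / (7 * c))"
  have bound: "\<bar>cdf M x - cdf N x\<bar> \<le> C * ((LINT t:{0..1}|lborel. g t) + m)"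
    if M: "real_distribution M" and N: "real_distribution N"
      and m: "\<And>x y. \<bar>cdf N x - cdf N y\<bar> \<le> m * \<bar>x - y\<bar>" and g: "set_integrable lborel {0..1} g"
      and le: "\<And>t. 0 < t \<Longrightarrow> t \<le> 1 \<Longrightarrow> norm (char M t - char N t) \<le> t * g t"
    for M N g m x
  proof -
    interpret M: real_distribution M by fact
    interpret N: real_distribution N by fact
    define D where "D = (\<lambda>x. cdf M x - cdf N x)"
    define J where "J = (LINT t:{0..1}|lborel. g t)"
    define \<eta> where "\<eta> = (SUP x. \<bar>D x\<bar>)"
    have m0: "m \<ge> 0" using m[of 0 1] by (simp add: order.trans[OF abs_ge_zero])
    have J: "\<bar>LINT s|fejer_measure. D (b + s)\<bar> \<le> 4 * J" for b
      unfolding D_def J_def by (rule fejer_smoothing_bound[OF M N g le])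
    have J0: "J \<ge> 0" using J[of 0] by linarith
    have D1: "\<bar>D x\<bar> \<le> 1" for x
      using M.cdf_nonneg[of x] M.cdf_bounded_prob[of x] N.cdf_nonneg[of x] N.cdf_bounded_prob[of x]
      by (simp add: D_def)
    have bdd: "bdd_above (range (\<lambda>x. \<bar>D x\<bar>))" using D1 by (intro bdd_aboveI[of _ 1]) auto
    have D_le: "\<bar>D x\<bar> \<le> \<eta>" for x unfolding \<eta>_def by (rule cSUP_upper[OF _ bdd]) auto
    have \<eta>0: "\<eta> \<ge> 0" using D_le[of 0] by linarith
    have "mono (cdf M)" "mono (cdf N)"
      using M.cdf_nondecreasing N.cdf_nondecreasing by (auto simp: mono_def)
    from this[THEN borel_measurable_mono] have [measurable]: "D \<in> borel_measurable borel"
      unfolding D_def by measurable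
    have intD: "integrable fejer_measure (\<lambda>s. D (b + s))" for b
      by (rule fejer.integrable_const_bound[of _ 1]) (auto simp: D1)
    have core: "d * (7/8 * c) \<le> 4 * J + \<eta> * (c / 8)"
      if d: "d \<ge> 0" and \<sigma>: "\<sigma> \<in> {-1, 1}" and near: "\<And>s. \<bar>s\<bar> \<le> A \<Longrightarrow> d \<le> \<sigma> * D (b + s)" for d \<sigma> b
    proof -
      define I where "I = {-A..A}"
      have le_c: "measure fejer_measure (-I) \<le> c / 8" using A by (simp add: I_def)
      have ge_c: "measure fejer_measure I \<ge> 7/8 * c"
        using le_c fejer.finite_measure_compl[of I] by (simp add: I_def c_def Compl_eq_Diff_UNIV)
      have "d * (7/8 * c) - \<eta> * (c / 8) \<le> d * measure fejer_measure I - \<eta> * measure fejer_measure (-I)"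
        using d \<eta>0 le_c ge_c by (intro diff_mono mult_left_mono) auto
      also have "\<dots> = (LINT s|fejer_measure. d * indicator I s - \<eta> * indicator (-I) s)"
        by (simp add: I_def fejer.emeasure_eq_measure)
      also have "\<dots> \<le> (LINT s|fejer_measure. \<sigma> * D (b + s))"
      proof (rule integral_mono)
        fix s
        have "- \<eta> \<le> \<sigma> * D (b + s)" using D_le[of "b + s"] \<sigma> by auto
        thus "d * indicator I s - \<eta> * indicator (-I) s \<le> \<sigma> * D (b + s)"
          using near[of s] by (auto simp: I_def abs_le_iff split: split_indicator)
      qed (use intD in \<open>auto simp: I_def fejer.emeasure_eq_measure\<close>)
      also have "\<dots> = \<sigma> * (LINT s|fejer_measure. D (b + s))" by simp
      also have "\<dots> \<le> 4 * J" using J[of b] \<sigma> by auto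
      finally show ?thesis by simp
    qed
    have each: "\<bar>D y\<bar> \<le> 2 * A * m + 32 * J / (7 * c) + \<eta> / 7" for y
    proof (cases "\<bar>D y\<bar> \<le> 2 * A * m")
      case True
      moreover have "0 \<le> 32 * J / (7 * c)" using J0 c by simp
      ultimately show ?thesis using \<eta>0 by linarith
    next
      case False
      define d where "d = \<bar>D y\<bar> - 2 * A * m"
      have d: "d \<ge> 0" using False by (simp add: d_def)
      have "d * (7/8 * c) \<le> 4 * J + \<eta> * (c / 8)"
      proof (cases "D y \<ge> 0")
        case True
        show ?thesis
        proof (rule core[of d 1 "y + A"])
          fix s assume s: "\<bar>s\<bar> \<le> A"
          have "cdf M y \<le> cdf M (y + A + s)" using s by (intro M.cdf_nondecreasing) auto
          moreover have "\<bar>cdf N (y + A + s) - cdf N y\<bar> \<le> m * (2 * A)"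
            using s m0 by (intro order.trans[OF m] mult_left_mono) auto
          hence "\<bar>cdf N (y + A + s) - cdf N y\<bar> \<le> 2 * A * m" by (simp add: mult_ac)
          ultimately show "d \<le> 1 * D (y + A + s)" using True by (simp add: d_def D_def)
        qed (use d in auto)
      next
        case neg: False
        show ?thesis
        proof (rule core[of d "-1" "y - A"])
          fix s assume s: "\<bar>s\<bar> \<le> A"
          have "cdf M (y - A + s) \<le> cdf M y" using s by (intro M.cdf_nondecreasing) auto
          moreover have "\<bar>cdf N (y - A + s) - cdf N y\<bar> \<le> m * (2 * A)"
            using s m0 by (intro order.trans[OF m] mult_left_mono) auto
          hence "\<bar>cdf N (y - A + s) - cdf N y\<bar> \<le> 2 * A * m" by (simp add: mult_ac)
          ultimately show "d \<le> - 1 * D (y - A + s)" using neg by (simp add: d_def D_def)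
        qed (use d in auto)
      qed
      hence "d \<le> 32 * J / (7 * c) + \<eta> / 7" using c by (simp add: field_simps)
      thus ?thesis by (simp add: d_def)
    qed
    have "\<eta> \<le> 2 * A * m + 32 * J / (7 * c) + \<eta> / 7"
      unfolding \<eta>_def by (rule cSUP_least) (use each in \<open>auto simp: \<eta>_def\<close>)
    hence "\<eta> \<le> 7/6 * (2 * A * m + 32 / (7 * c) * J)" by simp
    also have "\<dots> \<le> C * (J + m)"
    proof -
      have "0 \<le> 7/6 * (2 * A * J + 32 / (7 * c) * m)" using A c J0 m0 by simp
      also have "\<dots> = C * (J + m) - 7/6 * (2 * A * m + 32 / (7 * c) * J)"
        by (simp add: C_def algebra_simps add_divide_distrib)
      finally show ?thesis by simp
    qed
    finally show ?thesis using D_le[of x] by (simp add: D_def J_def)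
  qed
  have "C > 0" using A c by (simp add: C_def add_pos_pos)
  thus ?thesis using bound by blast
qed

section \<open>Convergence to the normal law\<close>

lemma cdf_std_normal_Lipschitz: "\<bar>cdf std_normal_distribution x - cdf std_normal_distribution y\<bar> \<le> \<bar>x - y\<bar>"
proof -
  interpret N: real_distribution std_normal_distribution by (rule real_dist_normal_dist)
  have dens: "std_normal_density u \<le> 1" for u
  proof -
    have "1 \<le> sqrt (2 * pi)" using pi_gt3 by simp
    hence "1 / sqrt (2 * pi) * exp (- u\<^sup>2 / 2) \<le> 1 * 1"
      by (intro mult_mono) (auto simp: divide_le_eq)
    thus ?thesis by (simp add: std_normal_density_def)
  qed
  have ord: "cdf std_normal_distribution x - cdf std_normal_distribution y \<le> x - y" if "y < x" for x y
  proof -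
    have "emeasure std_normal_distribution {y<..x} = (\<integral>\<^sup>+u. ennreal (std_normal_density u) * indicator {y<..x} u \<partial>lborel)"
      by (simp add: emeasure_density)
    also have "\<dots> \<le> (\<integral>\<^sup>+u. 1 * indicator {y<..x} u \<partial>lborel)"
      using dens by (intro nn_integral_mono mult_right_mono) (auto simp: ennreal_le_1)
    also have "\<dots> = ennreal (x - y)" using that by simp
    finally have "measure std_normal_distribution {y<..x} \<le> x - y"
      using that by (simp add: N.emeasure_eq_measure)
    thus ?thesis by (simp add: N.cdf_diff_eq[OF that])
  qed
  show ?thesis
    using ord[of y x] ord[of x y] N.cdf_nondecreasing[of x y] N.cdf_nondecreasing[of y x]
    by (cases x y rule: linorder_cases) auto
qed

lemma scaled_normal:
  fixes c :: real
  assumes "c > 0"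
  defines "N \<equiv> distr std_normal_distribution borel (\<lambda>x. c * x)"
  shows "real_distribution N" "cdf N x = cdf std_normal_distribution (x / c)"
    "char N t = of_real (exp (- (c * t)\<^sup>2 / 2))"
proof -
  interpret N0: real_distribution std_normal_distribution by (rule real_dist_normal_dist)
  show "real_distribution N" unfolding N_def by (rule N0.real_distribution_distr) simp
  have "(\<lambda>u. c * u) -` {..x} = {..x / c}" using assms by (auto simp: field_simps)
  thus "cdf N x = cdf std_normal_distribution (x / c)"
    by (simp add: cdf_def N_def measure_distr)
  have "char N t = char std_normal_distribution (c * t)"
    unfolding char_def N_def by (subst integral_distr) (auto simp: mult_ac)
  thus "char N t = of_real (exp (- (c * t)\<^sup>2 / 2))" by (simp add: char_std_normal_distribution)
qed

lemma mqs_char: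
  assumes "p \<le> n"
  shows "char (distr (mqs_input n p) borel (\<lambda>\<omega>. \<delta> * (X_mqs \<omega> - s))) t =
         passes_pgf p n (iexp (\<delta> * t)) * iexp (- (\<delta> * t) * s)"
proof -
  have "char (distr (mqs_input n p) borel (\<lambda>\<omega>. \<delta> * (X_mqs \<omega> - s))) t =
        (CLINT \<omega>|mqs_input n p. iexp (t * (\<delta> * (X_mqs \<omega> - s))))"
    unfolding char_def by (subst integral_distr) auto
  also have "\<dots> = (CLINT \<omega>|mqs_input n p. iexp (\<delta> * t) ^ num_passes \<omega> * iexp (- (\<delta> * t) * s))"
  proof (intro Bochner_Integration.integral_cong refl)
    fix \<omega>
    have "iexp (\<delta> * t) ^ num_passes \<omega> = exp (of_nat (num_passes \<omega>) * (\<i> * of_real (\<delta> * t)))"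
      by (rule exp_of_nat_mult [symmetric])
    hence "iexp (\<delta> * t) ^ num_passes \<omega> * iexp (- (\<delta> * t) * s) =
          exp (of_nat (num_passes \<omega>) * (\<i> * of_real (\<delta> * t)) + \<i> * of_real (- (\<delta> * t) * s))"
      by (simp only: exp_add)
    also have "of_nat (num_passes \<omega>) * (\<i> * of_real (\<delta> * t)) + \<i> * of_real (- (\<delta> * t) * s) =
               \<i> * of_real (t * (\<delta> * (X_mqs \<omega> - s)))"
      by (simp add: X_mqs_eq algebra_simps)
    finally show "iexp (t * (\<delta> * (X_mqs \<omega> - s))) = iexp (\<delta> * t) ^ num_passes \<omega> * iexp (- (\<delta> * t) * s)" ..
  qed
  also have "\<dots> = passes_pgf p n (iexp (\<delta> * t)) * iexp (- (\<delta> * t) * s)"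
    unfolding passes_pgf_eq[OF assms] by (intro Bochner_Integration.integral_mult_left integrable_measure_pmf_finite[OF finite_mqs_input[OF assms]])
  finally show ?thesis .
qed

lemma integral_Cauchy_density:
  assumes c: "c > 0" and K: "K \<ge> 0" "L \<ge> 0"
  defines "g \<equiv> (\<lambda>t::real. K / (1 + (c * t)\<^sup>2) + L)"
  shows "set_integrable lborel {0..1} g" "(LINT t:{0..1}|lborel. g t) \<le> 2 * K / c + L"
proof -
  have pos: "1 + (c * t)\<^sup>2 > 0" for t by (simp add: add_pos_nonneg)
  hence ne: "1 + (c * t)\<^sup>2 \<noteq> 0" for t by (metis less_irrefl)
  have cont: "continuous_on {0..1} g"
    unfolding g_def using ne by (intro continuous_intros) auto
  thus "set_integrable lborel {0..1} g" by (rule borel_integrable_atLeastAtMost')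
  have "(LINT t:{0..1}|lborel. g t) = (K / c * arctan (c * 1) + L * 1) - (K / c * arctan (c * 0) + L * 0)"
    unfolding set_lebesgue_integral_def
  proof (rule integral_FTC_atLeastAtMost[OF _ _ cont])
    fix t :: real
    have "((\<lambda>t. K / c * arctan (c * t) + L * t) has_real_derivative g t) (at t within {0..1})"
    proof -
      have "((\<lambda>t. c * t) has_real_derivative c) (at t within {0..1})"
        by (auto intro!: derivative_eq_intros)
      from DERIV_add[OF DERIV_cmult[OF DERIV_chain2[OF DERIV_arctan this], of "K / c"] DERIV_cmult_Id[of L]]
      show ?thesis using c by (simp add: g_def inverse_eq_divide)
    qed
    thus "((\<lambda>t. K / c * arctan (c * t) + L * t) has_vector_derivative g t) (at t within {0..1})"
      by (simp add: has_real_derivative_iff_has_vector_derivative)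
  qed auto
  also have "\<dots> \<le> K / c * 2 + L"
    using arctan_ubound[of c] pi_less_4 K c by (intro diff_le_eq[THEN iffD2]) (auto intro!: add_mono mult_left_mono divide_right_mono)
  finally show "(LINT t:{0..1}|lborel. g t) \<le> 2 * K / c + L" by (simp add: mult.commute)
qed

text \<open>
  The smoothing inequality is applied to \<open>\<delta> (X - s)\<close> with \<open>s = 2 p log n\<close>, so that the frequencies in
  \<open>[0, 1]\<close> are those for which the generating function is under control. The comparison law is normal with
  standard deviation \<open>\<delta> sqrt s\<close>, whose distribution function has Lipschitz constant of order
  \<open>1 / sqrt s\<close>.
\<close>

lemma mqs_Berry_Esseen:
  assumes p: "p \<ge> 1"
  shows "\<exists>C. \<forall>n\<ge>p+1. \<forall>x.
     \<bar>measure_pmf.prob (mqs_input n p)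
        {\<omega>. (X_mqs \<omega> - 2 * real p * ln (real n)) / sqrt (2 * real p * ln (real n)) < x}
      - cdf std_normal_distribution x\<bar> \<le> C * (1 / sqrt (ln (real n)))"
proof -
  obtain \<delta> K where \<delta>: "\<delta> > 0" and K: "K \<ge> 0" and
    bound: "\<And>n \<theta>. n \<ge> p + 1 \<Longrightarrow> 0 \<le> \<theta> \<Longrightarrow> \<theta> \<le> \<delta> \<Longrightarrow>
     norm (passes_pgf p n (iexp \<theta>) * iexp (- \<theta> * (2 * real p * ln (real n))) - exp (- (2 * real p * ln (real n)) * \<theta>\<^sup>2 / 2))
       \<le> \<theta> * (K / (1 + 2 * real p * ln (real n) * \<theta>\<^sup>2) + K / sqrt (ln (real n)))"
    using passes_pgf_iexp[OF p] by blast
  obtain C0 where C0: "C0 > 0" and Esseen: "\<And>M N g m x. real_distribution M \<Longrightarrow> real_distribution N \<Longrightarrow>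
     (\<And>x y. \<bar>cdf N x - cdf N y\<bar> \<le> m * \<bar>x - y\<bar>) \<Longrightarrow> set_integrable lborel {0..1} g \<Longrightarrow>
     (\<And>t. 0 < t \<Longrightarrow> t \<le> 1 \<Longrightarrow> norm (char M t - char N t) \<le> t * g t) \<Longrightarrow>
     \<bar>cdf M x - cdf N x\<bar> \<le> C0 * ((LINT t:{0..1}|lborel. g t) + m)"
    using Esseen_smoothing_unit by blast
  define C where "C = C0 * ((2 * K + \<delta> * K) + 1 / \<delta>)"
  show ?thesis
  proof (intro exI[of _ C] allI impI)
    fix n :: nat and x :: real assume n: "n \<ge> p + 1"
    define s where "s = 2 * real p * ln (real n)"
    define \<sigma> where "\<sigma> = sqrt s"
    define q where "q = sqrt (ln (real n))"
    have lnn: "ln (real n) > 0" using n p by simp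
    have q: "q > 0" using lnn by (simp add: q_def)
    have s: "s > 0" using lnn p by (simp add: s_def)
    have \<sigma>: "\<sigma> > 0" "\<sigma>\<^sup>2 = s" using s by (auto simp: \<sigma>_def)
    have "ln (real n) \<le> s" using lnn p by (simp add: s_def)
    hence q\<sigma>: "q \<le> \<sigma>" by (simp add: q_def \<sigma>_def)
    define c where "c = \<delta> * \<sigma>"
    have c: "c > 0" using \<delta> \<sigma> by (simp add: c_def)
    define M where "M = distr (mqs_input n p) borel (\<lambda>\<omega>. \<delta> * (X_mqs \<omega> - s))"
    define N where "N = distr std_normal_distribution borel (\<lambda>x. c * x)"
    note N = scaled_normal[OF c, folded N_def]
    have M: "real_distribution M"
      unfolding M_def by (rule prob_space.real_distribution_distr[OF prob_space_measure_pmf]) simp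
    interpret M: real_distribution M by fact
    interpret N: real_distribution N by (rule N)
    define g where "g = (\<lambda>t::real. (\<delta> * K) / (1 + (c * t)\<^sup>2) + \<delta> * K / q)"
    have lip: "\<bar>cdf N x - cdf N y\<bar> \<le> 1 / c * \<bar>x - y\<bar>" for x y
      using cdf_std_normal_Lipschitz[of "x / c" "y / c"] c
      by (simp add: N diff_divide_distrib [symmetric])
    have main: "\<bar>cdf M x - cdf N x\<bar> \<le> C * (1 / q)" for x
    proof -
      have "\<bar>cdf M x - cdf N x\<bar> \<le> C0 * ((LINT t:{0..1}|lborel. g t) + 1 / c)"
      proof (rule Esseen[OF M N(1) lip])
        show "set_integrable lborel {0..1} g"
          unfolding g_def using c \<delta> K q by (intro integral_Cauchy_density) auto
        fix t :: real assume t: "0 < t" "t \<le> 1"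
        have "char M t - char N t = passes_pgf p n (iexp (\<delta> * t)) * iexp (- (\<delta> * t) * s) - exp (- s * (\<delta> * t)\<^sup>2 / 2)"
          using n by (simp add: M_def mqs_char N c_def power_mult_distrib \<sigma> mult_ac)
        also have "norm \<dots> \<le> (\<delta> * t) * (K / (1 + s * (\<delta> * t)\<^sup>2) + K / q)"
          using bound[OF n, of "\<delta> * t"] \<delta> t by (simp add: s_def q_def)
        also have "\<dots> = t * g t"
          by (simp add: g_def c_def power_mult_distrib \<sigma> algebra_simps)
        finally show "norm (char M t - char N t) \<le> t * g t" .
      qed
      also have "(LINT t:{0..1}|lborel. g t) \<le> 2 * (\<delta> * K) / c + \<delta> * K / q"
        unfolding g_def using c \<delta> K q by (intro integral_Cauchy_density) auto
      hence "C0 * ((LINT t:{0..1}|lborel. g t) + 1 / c) \<le> C0 * ((2 * K / \<sigma> + \<delta> * K / q) + 1 / \<delta> / \<sigma>)"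
        using C0 \<delta> by (intro mult_left_mono) (auto simp: c_def)
      also have "\<dots> \<le> C0 * ((2 * K / q + \<delta> * K / q) + 1 / \<delta> / q)"
        using C0 \<delta> K q q\<sigma> by (intro mult_left_mono add_mono divide_left_mono order.refl) auto
      also have "\<dots> = C * (1 / q)" using q \<delta> by (simp add: C_def field_simps)
      finally show ?thesis .
    qed
    let ?A = "{\<omega>. (X_mqs \<omega> - 2 * real p * ln (real n)) / sqrt (2 * real p * ln (real n)) < x}"
    have "(y - s) / \<sigma> < x \<longleftrightarrow> \<delta> * (y - s) < c * x" for y
      using \<sigma>(1) \<delta> by (simp add: c_def divide_less_eq mult.assoc mult.commute[of x])
    hence "?A = (\<lambda>\<omega>. \<delta> * (X_mqs \<omega> - s)) -` {..<c * x}"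
      unfolding s_def [symmetric] \<sigma>_def [symmetric] by auto
    hence A: "measure_pmf.prob (mqs_input n p) ?A = measure M {..<c * x}"
      by (simp add: M_def measure_distr)
    have "((\<lambda>y. \<bar>cdf M y - cdf N y\<bar>) \<longlongrightarrow> \<bar>measure M {..<c * x} - measure N {..<c * x}\<bar>) (at_left (c * x))"
      by (intro tendsto_intros M.cdf_at_left N.cdf_at_left)
    hence "\<bar>measure M {..<c * x} - measure N {..<c * x}\<bar> \<le> C * (1 / q)"
      by (rule tendsto_upperbound) (use main in auto)
    moreover have "measure N {..<c * x} = cdf N (c * x)"
    proof -
      have "isCont (cdf N) (c * x)"
      proof -
        have "(1 / c)-lipschitz_on UNIV (cdf N)"
          using lip c by (intro lipschitz_onI) (auto simp: dist_real_def)
        hence "continuous_on UNIV (cdf N)" by (rule lipschitz_on_continuous_on)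
        thus ?thesis by (simp add: continuous_on_eq_continuous_at)
      qed
      hence "(cdf N \<longlongrightarrow> cdf N (c * x)) (at_left (c * x))"
        unfolding isCont_def by (rule tendsto_within_subset) auto
      from tendsto_unique[OF _ N.cdf_at_left this] show ?thesis by simp
    qed
    moreover have "cdf N (c * x) = cdf std_normal_distribution x" using c by (simp add: N)
    ultimately show "\<bar>measure_pmf.prob (mqs_input n p) ?A - cdf std_normal_distribution x\<bar> \<le> C * (1 / sqrt (ln (real n)))"
      by (simp add: A q_def)
  qed
qed

theorem theorem4:
  fixes p :: nat
  assumes "p \<ge> 1"
  shows "(\<exists>C::real. \<forall>\<^sub>F n in sequentially. \<forall>x::real.
            \<bar>measure_pmf.prob (mqs_input n p)
                {\<omega>. (X_mqs \<omega> - 2 * real p * ln (real n)) / sqrt (2 * real p * ln (real n)) < x}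
             - cdf std_normal_distribution x\<bar> \<le> C * (1 / sqrt (ln (real n))))
       \<and> (\<forall>\<epsilon>::real. \<epsilon> > 0 \<longrightarrow>
            (\<lambda>n. E_mqs n p
                 - (2 * real p * ln (real n) + 1 - 2 * real p - 2 * real p * harm p
                    + 2 * real p * euler_mascheroni))
              \<in> O[sequentially](\<lambda>n. 1 / real n powr (1 - \<epsilon>))
          \<and> (\<lambda>n. V_mqs n p
                 - (2 * real p * ln (real n) + 4 * real p - 2 - 2 * real p * harm p
                    + 2 * real p * euler_mascheroni + 4 * (real p)\<^sup>2 * harm2 p
                    - 2 / 3 * pi\<^sup>2 * (real p)\<^sup>2))
              \<in> O[sequentially](\<lambda>n. 1 / real n powr (1 - \<epsilon>)))"
proof (intro conjI allI impI)
  obtain C where "\<forall>n\<ge>p+1. \<forall>x.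
     \<bar>measure_pmf.prob (mqs_input n p)
        {\<omega>. (X_mqs \<omega> - 2 * real p * ln (real n)) / sqrt (2 * real p * ln (real n)) < x}
      - cdf std_normal_distribution x\<bar> \<le> C * (1 / sqrt (ln (real n)))"
    using mqs_Berry_Esseen[OF assms] by blast
  thus "\<exists>C::real. \<forall>\<^sub>F n in sequentially. \<forall>x::real.
            \<bar>measure_pmf.prob (mqs_input n p)
                {\<omega>. (X_mqs \<omega> - 2 * real p * ln (real n)) / sqrt (2 * real p * ln (real n)) < x}
             - cdf std_normal_distribution x\<bar> \<le> C * (1 / sqrt (ln (real n)))"
    by (intro exI[of _ C] eventually_sequentiallyI[of "p + 1"]) blast
qed (use moment_asymptotics[OF assms] in blast)+

end
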